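(* Let $X$ be a real reflexive Banach space with dual space $X^*$, let $n\in\{2,3,\dots\}$, and let $S:X\rightrightarrows X^*$ be an $n$-monotone set-valued operator with $G(S)\neq\emptyset$. Suppose that $\langle x^*,x\rangle\le F_{S,n}^*(x^*,x)$ for all $(x^*,x)\in X^*\times X$. Let $B:X\to X^*$ be a linear, continuous and monotone operator. Then for every $$w^*\in\operatorname{core}\Big(\{x^*-B^*x:(x^*,x)\in\operatorname{dom}F_{S,n}^*\}+\operatorname{Im}(B+B^* )+\operatorname{bar}D(S)\Big)$$ there exists $x\in\operatorname{cl}\operatorname{co}D(S)$ such that $\{(x,w^*-Bx)\}\cup G(S)$ is $n$-monotone.
   Context: $\langle x^*,x\rangle$ denotes the value of $x^*\in X^*$ at $x\in X$; $\overline{\mathbb{R}}=\mathbb{R}\cup\{\pm\infty\}$; $\operatorname{cl}$ and $\operatorname{co}$ denote (norm) closure and convex hull; $\operatorname{dom}f=\{z:f(z)<+\infty\}$ for an $\overline{\mathbb{R}}$-valued function $f$; sums of sets are Minkowski sums; $\operatorname{Im}$ denotes the image (range) of a linear operator. $\operatorname{core}C$ denotes the algebraic interior of a subset $C$ of a vector space $Z$; for convex $C$, $z\in\operatorname{core}C$ if and only if $\bigcup_{\lambda\ge 0}\lambda(C-z)=Z$. For $C\subseteq X$, the barrier cone is $\operatorname{bar}C=\operatorname{dom}\sigma_C=\{x^*\in X^*:\sup_{x\in C}\langle x^*,x\rangle<+\infty\}$. For a set-valued operator $S:X\rightrightarrows X^*$, the graph is $G(S)=\{(x,x^* )\in X\times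 X^*: x^*\in S(x)\}$ and the domain is $D(S)=\{x\in X:S(x)\neq\emptyset\}$. For an integer $n\ge 2$, $S$ is $n$-monotone (also called $n$-cyclically monotone) if $\sum_{i=1}^n\langle s_i^*,s_{i+1}-s_i\rangle\le 0$ for all $(s_1,s_1^* ),\dots,(s_n,s_n^* )\in G(S)$, where $s_{n+1}=s_1$. A subset of $X\times X^*$ is called $n$-monotone if the operator having it as its graph is $n$-monotone. Monotone means $2$-monotone; for a linear operator $B:X\to X^*$ this means $\langle Bx,x\rangle\ge 0$ for all $x\in X$. The Fitzpatrick function of order $n$ of $S$ is $F_{S,n}:X\times X^*\to\overline{\mathbb{R}}$, $$F_{S,n}(x,x^* )=\sup\Big\{\sum_{i=1}^{n-2}\langle s_i^*,s_{i+1}-s_i\rangle+\langle s_{n-1}^*,x-s_{n-1}\rangle+\langle x^*,s_1\rangle : (s_i,s_i^* )\in G(S),\ i=1,\dots,n-1\Big\}$$ (for $n=2$ the sum over $i$ is empty). Identifying $X^{**}$ with $X$ by reflexivity, its Fenchel conjugate is $F_{S,n}^*:X^*\times X\to\overline{\mathbb{R}}$, $F_{S,n}^*(x^*,x)=\sup_{(y,y^* )\in X\times X^*}\{\langle x^*,y\rangle+\langle y^*,x\rangle-F_{S,n}(y,y^* )\}$. The adjoint of a linear continuous operator $B:X\to X^*$ is regarded, by reflexivity, as the operator $B^*:X\to X^*$ given by $\langle B^*x,y\rangle=\langle By,x\rangle$ for all $x,y\in X$. *)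

theory Defs
  imports "HOL-Analysis.Analysis"
begin

type_synonym 'a dual = "'a \<Rightarrow>\<^sub>L real"

lift_definition canonical_embedding :: "'a::real_normed_vector \<Rightarrow> 'a dual dual"
  is "\<lambda>x f. blinfun_apply f x"
  by (rule blinfun.bounded_linear_left)

definition reflexive_space :: "'a::real_normed_vector itself \<Rightarrow> bool" where
  "reflexive_space _ \<longleftrightarrow> surj (canonical_embedding :: 'a \<Rightarrow> 'a dual dual)"

definition effective_domain :: "('z \<Rightarrow> ereal) \<Rightarrow> 'z set" where
  "effective_domain f = {z. f z < \<infinity>}"

definition core :: "'z::real_vector set \<Rightarrow> 'z set" where
  "core C = {z \<in> C. \<forall>v. \<exists>\<delta>>0. \<forall>t\<in>{0..\<delta>}. z + t *\<^sub>R v \<in> C}"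

definition support_function :: "'a::real_normed_vector set \<Rightarrow> 'a dual \<Rightarrow> ereal" where
  "support_function C xs = (SUP x\<in>C. ereal (blinfun_apply xs x))"

definition barrier_cone :: "'a::real_normed_vector set \<Rightarrow> 'a dual set" where
  "barrier_cone C = effective_domain (support_function C)"

definition op_graph :: "('a \<Rightarrow> 'b set) \<Rightarrow> ('a \<times> 'b) set" where
  "op_graph S = {(x, xs). xs \<in> S x}"

definition op_domain :: "('a \<Rightarrow> 'b set) \<Rightarrow> 'a set" where
  "op_domain S = {x. S x \<noteq> {}}"

text \<open>Sequences are indexed from 1; their values outside the relevant index range are irrelevant.\<close>

definition n_monotone_set :: "nat \<Rightarrow> ('a::real_normed_vector \<times> 'a dual) set \<Rightarrow> bool" where
  "n_monotone_set n G \<longleftrightarrow>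
     (\<forall>s. (\<forall>i\<in>{1..n}. s i \<in> G) \<and> s (n + 1) = s 1 \<longrightarrow>
        (\<Sum>i=1..n. blinfun_apply (snd (s i)) (fst (s (i + 1)) - fst (s i))) \<le> 0)"

definition n_monotone :: "nat \<Rightarrow> ('a::real_normed_vector \<Rightarrow> 'a dual set) \<Rightarrow> bool" where
  "n_monotone n S \<longleftrightarrow> n_monotone_set n (op_graph S)"

definition fitzpatrick ::
    "nat \<Rightarrow> ('a::real_normed_vector \<Rightarrow> 'a dual set) \<Rightarrow> 'a \<times> 'a dual \<Rightarrow> ereal" where
  "fitzpatrick n S = (\<lambda>(x, xs).
     SUP s\<in>{s. \<forall>i\<in>{1..n - 1}. s i \<in> op_graph S}.
       ereal ((\<Sum>i=1..n - 2. blinfun_apply (snd (s i)) (fst (s (i + 1)) - fst (s i)))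
              + blinfun_apply (snd (s (n - 1))) (x - fst (s (n - 1)))
              + blinfun_apply xs (fst (s 1))))"

text \<open>The bidual is identified with the space itself, so for reflexive spaces this is the
  Fenchel conjugate of a function on \<open>X \<times> X*\<close>.\<close>

definition fenchel_conjugate ::
    "('a::real_normed_vector \<times> 'a dual \<Rightarrow> ereal) \<Rightarrow> 'a dual \<times> 'a \<Rightarrow> ereal" where
  "fenchel_conjugate f = (\<lambda>(xs, x).
     SUP (y, ys)\<in>UNIV. ereal (blinfun_apply xs y + blinfun_apply ys x) - f (y, ys))"

text \<open>The adjoint, with the bidual again identified with the space; it is characterised by
  \<open>blinfun_adjoint_apply\<close> below.\<close>

lift_definition blinfun_adjoint ::
    "('a::real_normed_vector \<Rightarrow>\<^sub>L 'a dual) \<Rightarrow> ('a \<Rightarrow>\<^sub>L 'a dual)"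
  is "\<lambda>B x. Blinfun (\<lambda>y. blinfun_apply (B y) x)"
proof -
  fix B :: "'a \<Rightarrow> 'a dual"
  assume B: "bounded_linear B"
  have lin: "bounded_linear (\<lambda>y. blinfun_apply (B y) x)" for x
    by (rule bounded_linear_compose[OF blinfun.bounded_linear_left B])
  have app: "blinfun_apply (Blinfun (\<lambda>y. blinfun_apply (B y) x)) y = blinfun_apply (B y) x" for x y
    by (simp add: bounded_linear_Blinfun_apply lin)
  obtain K where K: "\<And>y. norm (B y) \<le> norm y * K" "K > 0"
    using bounded_linear.pos_bounded[OF B] by blast
  show "bounded_linear (\<lambda>x. Blinfun (\<lambda>y. blinfun_apply (B y) x))"
  proof (rule bounded_linear_intro[where K = K])
    fix x
    show "norm (Blinfun (\<lambda>y. blinfun_apply (B y) x)) \<le> norm x * K"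
    proof (rule norm_blinfun_bound)
      show "0 \<le> norm x * K" using K(2) by simp
      fix y
      have "norm (blinfun_apply (B y) x) \<le> norm (B y) * norm x" by (rule norm_blinfun)
      also have "\<dots> \<le> norm y * K * norm x" by (intro mult_right_mono K(1)) simp
      finally show "norm (blinfun_apply (Blinfun (\<lambda>y. blinfun_apply (B y) x)) y) \<le> norm x * K * norm y"
        by (simp add: app mult_ac)
    qed
  next
    fix x y
    show "Blinfun (\<lambda>z. blinfun_apply (B z) (x + y))
        = Blinfun (\<lambda>z. blinfun_apply (B z) x) + Blinfun (\<lambda>z. blinfun_apply (B z) y)"
      by (rule blinfun_eqI) (simp only: app blinfun.add_left, simp only: blinfun.add_right)
  next
    fix r x
    show "Blinfun (\<lambda>z. blinfun_apply (B z) (r *\<^sub>R x)) = r *\<^sub>R Blinfun (\<lambda>z. blinfun_apply (B z) x)"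
      by (rule blinfun_eqI) (simp only: app blinfun.scaleR_left, simp only: blinfun.scaleR_right)
  qed
qed

lemma blinfun_adjoint_apply:
  "blinfun_apply (blinfun_apply (blinfun_adjoint B) x) y = blinfun_apply (blinfun_apply B y) x"
  by transfer
     (simp add: bounded_linear_Blinfun_apply bounded_linear_compose[OF blinfun.bounded_linear_left])

lemma core_convex_iff:
  fixes C :: "'z::real_vector set"
  assumes "convex C"
  shows "z \<in> core C \<longleftrightarrow> (\<Union>r\<in>{0..}. (\<lambda>c. r *\<^sub>R (c - z)) ` C) = UNIV"
proof
  assume z: "z \<in> core C"
  have "v \<in> (\<Union>r\<in>{0..}. (\<lambda>c. r *\<^sub>R (c - z)) ` C)" for v
  proof -
    obtain \<delta> where d: "\<delta> > 0" "\<forall>t\<in>{0..\<delta>}. z + t *\<^sub>R v \<in> C"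
      using z unfolding core_def by blast
    then have "z + \<delta> *\<^sub>R v \<in> C" by simp
    moreover have "v = (1 / \<delta>) *\<^sub>R ((z + \<delta> *\<^sub>R v) - z)" using d(1) by simp
    moreover have "1 / \<delta> \<in> {0..}" using d(1) by simp
    ultimately show ?thesis by blast
  qed
  then show "(\<Union>r\<in>{0..}. (\<lambda>c. r *\<^sub>R (c - z)) ` C) = UNIV" by blast
next
  assume U: "(\<Union>r\<in>{0..}. (\<lambda>c. r *\<^sub>R (c - z)) ` C) = UNIV"
  have cone: "\<exists>l c. l \<ge> 0 \<and> c \<in> C \<and> v = l *\<^sub>R (c - z)" for v
  proof -
    have "v \<in> (\<Union>r\<in>{0..}. (\<lambda>c. r *\<^sub>R (c - z)) ` C)" using U by simp
    then show ?thesis by auto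
  qed
  have pos: "\<exists>\<delta>>0. z + \<delta> *\<^sub>R v \<in> C" if "v \<noteq> 0" for v
  proof -
    obtain l c where lc: "l \<ge> 0" "c \<in> C" "v = l *\<^sub>R (c - z)" using cone by blast
    then have "l > 0" using that by (cases "l = 0") auto
    then have "z + (1 / l) *\<^sub>R v = c" using lc by simp
    then show ?thesis using \<open>l > 0\<close> lc(2) by (intro exI[of _ "1 / l"]) simp
  qed
  have zC: "z \<in> C"
  proof (cases "\<exists>v::'z. v \<noteq> 0")
    case True
    then obtain v :: 'z where v: "v \<noteq> 0" by blast
    obtain a where a: "a > 0" "z + a *\<^sub>R v \<in> C" using pos[OF v] by blast
    obtain b where b: "b > 0" "z + b *\<^sub>R (- v) \<in> C" using pos[of "- v"] v by auto
    have ab: "a + b > 0" using a b by simp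
    have "(b / (a + b)) *\<^sub>R (z + a *\<^sub>R v) + (a / (a + b)) *\<^sub>R (z + b *\<^sub>R (- v)) \<in> C"
      using a b ab by (intro convexD[OF assms]) (auto simp: add_divide_distrib[symmetric])
    moreover have "(b / (a + b)) *\<^sub>R (z + a *\<^sub>R v) + (a / (a + b)) *\<^sub>R (z + b *\<^sub>R (- v))
        = (b / (a + b) + a / (a + b)) *\<^sub>R z"
      by (simp add: algebra_simps)
    moreover have "b / (a + b) + a / (a + b) = 1" using ab by (simp add: add_divide_distrib[symmetric])
    ultimately show ?thesis by (metis scaleR_one)
  next
    case False
    then have "\<And>c. c = z" by (metis)
    then show ?thesis using cone[of 0] by metis
  qed
  have "\<exists>\<delta>>0. \<forall>t\<in>{0..\<delta>}. z + t *\<^sub>R v \<in> C" for v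
  proof (cases "v = 0")
    case True
    then show ?thesis using zC by (intro exI[of _ 1]) simp
  next
    case False
    then obtain d where d: "d > 0" "z + d *\<^sub>R v \<in> C" using pos by blast
    have "z + t *\<^sub>R v \<in> C" if t: "t \<in> {0..d}" for t
    proof -
      have "(1 - t / d) *\<^sub>R z + (t / d) *\<^sub>R (z + d *\<^sub>R v) \<in> C"
        using t d zC by (intro convexD[OF assms]) auto
      moreover have "(1 - t / d) *\<^sub>R z + (t / d) *\<^sub>R (z + d *\<^sub>R v) = z + t *\<^sub>R v"
        using d(1) by (simp add: algebra_simps)
      ultimately show ?thesis by simp
    qed
    then show ?thesis using d(1) by blast
  qed
  then show "z \<in> core C" using zC unfolding core_def by blast
qed

lemma n_monotone_two_linear_iff:
  fixes B :: "'a::real_normed_vector \<Rightarrow>\<^sub>L 'a dual"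
  shows "n_monotone 2 (\<lambda>x. {blinfun_apply B x})
     \<longleftrightarrow> (\<forall>x. 0 \<le> blinfun_apply (blinfun_apply B x) x)"
proof
  assume L: "n_monotone 2 (\<lambda>x. {blinfun_apply B x})"
  show "\<forall>x. 0 \<le> blinfun_apply (blinfun_apply B x) x"
  proof
    fix x
    define s :: "nat \<Rightarrow> 'a \<times> 'a dual" where "s = (\<lambda>i. if i = 2 then (0, 0) else (x, blinfun_apply B x))"
    have "(\<Sum>i=1..2. blinfun_apply (snd (s i)) (fst (s (i + 1)) - fst (s i))) \<le> 0"
      using L unfolding n_monotone_def n_monotone_set_def
      by (rule allE[of _ s]) (auto simp: s_def op_graph_def)
    then show "0 \<le> blinfun_apply (blinfun_apply B x) x"
      by (simp add: s_def numeral_2_eq_2 blinfun.bilinear_simps)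
  qed
next
  assume R: "\<forall>x. 0 \<le> blinfun_apply (blinfun_apply B x) x"
  show "n_monotone 2 (\<lambda>x. {blinfun_apply B x})"
    unfolding n_monotone_def n_monotone_set_def
  proof (intro allI impI)
    fix s :: "nat \<Rightarrow> 'a \<times> 'a dual"
    assume s: "(\<forall>i\<in>{1..2}. s i \<in> op_graph (\<lambda>x. {blinfun_apply B x})) \<and> s (2 + 1) = s 1"
    then have e: "s (Suc (Suc (Suc 0))) = s 1" by (simp add: eval_nat_numeral)
    have g: "snd (s 1) = blinfun_apply B (fst (s 1))" "snd (s 2) = blinfun_apply B (fst (s 2))"
      using s by (auto simp: op_graph_def split_beta)
    have "{1..2} = {1, 2::nat}" by auto
    then have "(\<Sum>i=1..2. blinfun_apply (snd (s i)) (fst (s (i + 1)) - fst (s i)))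
        = blinfun_apply (snd (s 1)) (fst (s 2) - fst (s 1)) + blinfun_apply (snd (s 2)) (fst (s 1) - fst (s 2))"
      using e by (simp add: numeral_2_eq_2)
    also have "\<dots> = - blinfun_apply (blinfun_apply B (fst (s 1) - fst (s 2))) (fst (s 1) - fst (s 2))"
      by (simp only: g) (simp add: blinfun.bilinear_simps)
    also have "\<dots> \<le> 0" using R by simp
    finally show "(\<Sum>i=1..2. blinfun_apply (snd (s i)) (fst (s (i + 1)) - fst (s i))) \<le> 0" .
  qed
qed

end

theory Submission
  imports Defs
begin

text \<open>
  Write \<open>h = F\<^sub>S\<^sub>,\<^sub>n*\<close>, \<open>C = cl co D(S)\<close> and \<open>\<kappa>(p) = sup {\<langle>p, c\<rangle> - \<langle>B c, c\<rangle> | c \<in> C}\<close>, and consider on the dual space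
  the convex value function \<open>v(u) = inf {h(x*, x) + \<kappa>(p) - \<langle>w, x\<rangle> | x* - B*x + p = w + u}\<close>. Since \<open>h\<close>
  dominates the duality product and its domain lies over \<open>C\<close>, \<open>v(0) \<ge> 0\<close> (test \<open>\<kappa>\<close> with \<open>c = x\<close>). Monotonicity
  of \<open>B\<close> gives \<open>\<kappa> < \<infinity>\<close> on \<open>Im (B + B*) + bar C\<close>, so the core condition makes \<open>v\<close> finite around \<open>0\<close>, and a
  Baire category argument of open mapping type makes it bounded above on a ball. By Hahn-Banach
  and reflexivity there is \<open>y\<close> with \<open>\<langle>u, y\<rangle> \<le> v(u)\<close> for all \<open>u\<close>. Choosing \<open>p = t l\<close> with \<open>l\<close> separating
  \<open>y\<close> from \<open>C\<close> forces \<open>y \<in> C\<close>, and choosing \<open>p = (B + B*) y\<close> gives \<open>F\<^sub>S\<^sub>,\<^sub>n(y, w - B y) \<le> \<langle>w - B y, y\<rangle>\<close>, which means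
  that \<open>(y, w - B y)\<close> can be added to the graph: a cycle through that point splits at its
  occurrences into loops with one occurrence each.
\<close>

subsection \<open>Hahn-Banach\<close>

text \<open>Homogeneity is asked only as an inequality for \<open>t > 0\<close>, which is easy to
  check for infima; equality for all \<open>t \<ge> 0\<close> is recovered in
  \<open>sublinear_scaleR\<close>.\<close>

definition sublinear :: "('a::real_vector \<Rightarrow> real) \<Rightarrow> bool" where
  "sublinear p \<longleftrightarrow> (\<forall>x y. p (x + y) \<le> p x + p y) \<and> (\<forall>t>0. \<forall>x. p (t *\<^sub>R x) \<le> t * p x)"

lemma sublinearI:
  assumes "\<And>x y. p (x + y) \<le> p x + p y" "\<And>t x. t > 0 \<Longrightarrow> p (t *\<^sub>R x) \<le> t * p x"
  shows "sublinear p"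
  using assms by (auto simp: sublinear_def)

lemma sublinear_add: "sublinear p \<Longrightarrow> p (x + y) \<le> p x + p y"
  by (simp add: sublinear_def)

lemma sublinear_scaleR:
  assumes "sublinear p" "t \<ge> 0"
  shows "p (t *\<^sub>R x) = t * p x"
proof (cases "t = 0")
  case True
  \<comment> \<open>The factor 2 forces \<open>p 0 \<ge> 0\<close>, the factor 1/2 forces
    \<open>p 0 \<le> 0\<close>.\<close>
  have "p 0 \<le> 2 * p 0" "p 0 \<le> (1/2) * p 0"
    using assms(1) unfolding sublinear_def by (metis scaleR_zero_right zero_less_numeral,
      metis scaleR_zero_right zero_less_divide_1_iff zero_less_numeral)
  with True show ?thesis by simp
next
  case False
  with assms have t: "t > 0" by simp
  have "p ((1/t) *\<^sub>R (t *\<^sub>R x)) \<le> (1/t) * p (t *\<^sub>R x)"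
    using assms(1) t unfolding sublinear_def by (meson zero_less_divide_1_iff)
  then have "t * p x \<le> p (t *\<^sub>R x)" using t by (simp add: field_simps)
  moreover have "p (t *\<^sub>R x) \<le> t * p x" using assms(1) t by (simp add: sublinear_def)
  ultimately show ?thesis by simp
qed

lemma sublinear_lower:
  assumes "sublinear p"
  shows "- p (- x) \<le> p x"
  using sublinear_add[OF assms, of x "- x"] sublinear_scaleR[OF assms, of 0 0] by simp

text \<open>Serves two infima: over a chain of sublinear functionals, and over a real parameter
  where the single members are not sublinear. Hence the bound for \<open>x + y\<close> may use a
  third index \<open>k\<close>.\<close>

lemma sublinear_INF:
  assumes "I \<noteq> {}"
    and bdd: "\<And>x. bdd_below ((\<lambda>i. g i x) ` I)"
    and add: "\<And>i j x y. i \<in> I \<Longrightarrow> j \<in> I \<Longrightarrow> \<exists>k\<in>I. g k (x + y) \<le> g i x + g j y"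
    and scale: "\<And>i t x. i \<in> I \<Longrightarrow> t > 0 \<Longrightarrow> \<exists>k\<in>I. g k (t *\<^sub>R x) \<le> t * g i x"
  shows "sublinear (\<lambda>x. INF i\<in>I. g i x)"
proof (rule sublinearI)
  let ?u = "\<lambda>x. INF i\<in>I. g i x"
  have low: "?u x \<le> g i x" if "i \<in> I" for i x
    using that by (intro cINF_lower bdd)
  show "?u (x + y) \<le> ?u x + ?u y" for x y
  proof -
    have "?u (x + y) - g i x \<le> ?u y" if i: "i \<in> I" for i
    proof (rule cINF_greatest[OF assms(1)])
      fix j assume "j \<in> I"
      then obtain k where "k \<in> I" "g k (x + y) \<le> g i x + g j y" using add i by blast
      with low[of k "x + y"] show "?u (x + y) - g i x \<le> g j y" by linarith
    qed
    then have "?u (x + y) - ?u y \<le> g i x" if "i \<in> I" for i using that by (simp add: algebra_simps)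
    then have "?u (x + y) - ?u y \<le> ?u x" by (intro cINF_greatest[OF assms(1)])
    then show ?thesis by simp
  qed
  show "?u (t *\<^sub>R x) \<le> t * ?u x" if t: "t > 0" for t x
  proof -
    have "?u (t *\<^sub>R x) / t \<le> ?u x"
    proof (rule cINF_greatest[OF assms(1)])
      fix i assume "i \<in> I"
      then obtain k where "k \<in> I" "g k (t *\<^sub>R x) \<le> t * g i x" using scale t by blast
      with low[of k "t *\<^sub>R x"] show "?u (t *\<^sub>R x) / t \<le> g i x" using t by (simp add: field_simps)
    qed
    then show ?thesis using t by (simp add: field_simps)
  qed
qed

text \<open>For fixed \<open>y\<close> the functional
  \<open>inf {p (z + t y) - t p y | t \<ge> 0}\<close> of \<open>z\<close> is sublinear and below
  \<open>p\<close>, so by minimality it equals \<open>p\<close>. Its member \<open>t = 1\<close>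
  then says that \<open>p\<close> is superadditive.\<close>

lemma minimal_sublinear_linear:
  assumes p: "sublinear p" and min: "\<And>q. sublinear q \<Longrightarrow> q \<le> p \<Longrightarrow> q = p"
  shows "linear p"
proof -
  have super: "p x + p y \<le> p (x + y)" for x y
  proof -
    define g where "g = (\<lambda>t z. p (z + t *\<^sub>R y) - t * p y)"
    let ?q = "\<lambda>z. INF t\<in>{0..}. g t z"
    have bdd: "bdd_below ((\<lambda>t. g t z) ` {0..})" for z
    proof (rule bdd_belowI2)
      fix t :: real assume "t \<in> {0..}"
      with sublinear_add[OF p, of "z + t *\<^sub>R y" "- z"] sublinear_scaleR[OF p, of t y]
      show "- p (- z) \<le> g t z" by (simp add: g_def)
    qed
    have "sublinear ?q"
    proof (rule sublinear_INF[OF _ bdd])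
      fix s t :: real and z z' assume "s \<in> {0..}" "t \<in> {0..}"
      then have "s + t \<in> {0..}" by simp
      moreover have "g (s + t) (z + z') \<le> g s z + g t z'"
        using sublinear_add[OF p, of "z + s *\<^sub>R y" "z' + t *\<^sub>R y"] by (simp add: g_def algebra_simps)
      ultimately show "\<exists>k\<in>{0..}. g k (z + z') \<le> g s z + g t z'" by blast
    next
      fix s t :: real and z assume "s \<in> {0..}" "t > 0"
      then have "t * s \<in> {0..}" by simp
      moreover have "g (t * s) (t *\<^sub>R z) \<le> t * g s z"
        using sublinear_scaleR[OF p, of t "z + s *\<^sub>R y"] \<open>t > 0\<close> by (simp add: g_def algebra_simps)
      ultimately show "\<exists>k\<in>{0..}. g k (t *\<^sub>R z) \<le> t * g s z" by blast
    qed simp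
    moreover have "?q \<le> p"
    proof (rule le_funI)
      fix z show "?q z \<le> p z" using cINF_lower[OF bdd, of 0 z] by (simp add: g_def)
    qed
    ultimately have "?q = p" by (rule min)
    then have "p x = ?q x" by (simp add: fun_eq_iff)
    also have "\<dots> \<le> g 1 x" by (rule cINF_lower[OF bdd]) simp
    finally show ?thesis by (simp add: g_def)
  qed
  have add: "p (x + y) = p x + p y" for x y
    using super[of x y] sublinear_add[OF p, of x y] by simp
  have neg: "p (- x) = - p x" for x
    using add[of x "- x"] sublinear_scaleR[OF p, of 0 0] by simp
  have "p (t *\<^sub>R x) = t * p x" for t x
  proof (cases "t \<ge> 0")
    case False
    then have "p ((- t) *\<^sub>R x) = - t * p x" by (intro sublinear_scaleR[OF p]) simp
    then show ?thesis using neg[of "t *\<^sub>R x"] by simp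
  qed (simp add: sublinear_scaleR[OF p])
  with add show ?thesis by (intro linearI) simp_all
qed

theorem hahn_banach_sublinear:
  assumes q: "sublinear q"
  obtains f where "linear f" "\<And>x. f x \<le> q x"
proof -
  define A where "A = {p. sublinear p \<and> p \<le> q}"
  have "\<exists>m\<in>A. \<forall>a\<in>A. a \<le> m \<longrightarrow> a = m"
  proof (rule predicate_Zorn)
    \<comment> \<open>The order is reversed because Zorn's lemma delivers maximal elements and a
      minimal functional is wanted.\<close>
    show "partial_order_on A (relation_of (\<lambda>a b. b \<le> a) A)"
      by (rule partial_order_on_relation_ofI) auto
  next
    fix C assume C: "C \<in> Chains (relation_of (\<lambda>a b. b \<le> a) A)"
    then have CA: "C \<subseteq> A" by (rule Chains_relation_of)
    have cmp: "a \<le> b \<or> b \<le> a" if "a \<in> C" "b \<in> C" for a b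
      using C that unfolding Chains_def relation_of_def by auto
    show "\<exists>u\<in>A. \<forall>a\<in>C. u \<le> a"
    proof (cases "C = {}")
      case True
      then show ?thesis using q by (auto simp: A_def)
    next
      case False
      let ?u = "\<lambda>x. INF p\<in>C. p x"
      \<comment> \<open>All members share the bound
        \<open>- q (- x) \<le> - p (- x) \<le> p x\<close>.\<close>
      have bdd: "bdd_below ((\<lambda>p. p x) ` C)" for x
      proof (rule bdd_belowI2)
        fix p assume "p \<in> C"
        then have "sublinear p" "p (- x) \<le> q (- x)" using CA by (auto simp: A_def le_fun_def)
        with sublinear_lower[of p x] show "- q (- x) \<le> p x" by simp
      qed
      have le: "?u \<le> p" if "p \<in> C" for p
        by (rule le_funI) (rule cINF_lower[OF bdd that])
      have "sublinear ?u"
      proof (rule sublinear_INF[OF False bdd])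
        fix i j x y assume ij: "i \<in> C" "j \<in> C"
        then obtain k where k: "k \<in> C" "k \<le> i" "k \<le> j" using cmp by blast
        then have "k (x + y) \<le> k x + k y" using CA by (auto simp: A_def intro: sublinear_add)
        also have "\<dots> \<le> i x + j y" using k by (intro add_mono) (auto simp: le_fun_def)
        finally show "\<exists>k\<in>C. k (x + y) \<le> i x + j y" using k by blast
      next
        fix i x and t :: real assume "i \<in> C" "t > 0"
        then show "\<exists>k\<in>C. k (t *\<^sub>R x) \<le> t * i x"
          using CA by (intro bexI[of _ i]) (auto simp: A_def sublinear_def)
      qed
      moreover have "?u \<le> q" using False CA le by (fastforce simp: A_def)
      ultimately show ?thesis using le by (auto simp: A_def)
    qed
  qed
  then obtain m where m: "sublinear m" "m \<le> q" and
    min: "\<And>a. sublinear a \<Longrightarrow> a \<le> q \<Longrightarrow> a \<le> m \<Longrightarrow> a = m" by (auto simp: A_def)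
  have "linear m"
    using m min order_trans by (intro minimal_sublinear_linear) blast+
  with m(2) show ?thesis by (intro that) (auto simp: le_fun_def)
qed

text \<open>Think of \<open>P\<close> as the epigraph of a convex \<open>v\<close> with
  \<open>v 0 \<ge> 0\<close> and \<open>v \<le> M\<close> on a ball. Its positively homogeneous hull
  \<open>q x = inf {s v(x/s) | s > 0}\<close> is sublinear: \<open>v 0 \<ge> 0\<close> keeps it
  finite from below. Hahn-Banach gives a linear \<open>f \<le> q \<le> v\<close>, and the bound on
  the ball makes \<open>f\<close> continuous.\<close>

theorem convex_epigraph_affine_minorant:
  fixes P :: "('a::real_normed_vector \<times> real) set"
  assumes "convex P" "\<rho> > 0"
    and ball: "\<And>u. norm u < \<rho> \<Longrightarrow> (u, M) \<in> P"
    and nonneg: "\<And>r. (0, r) \<in> P \<Longrightarrow> 0 \<le> r"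
  obtains f :: "'a \<Rightarrow>\<^sub>L real" where "\<And>u r. (u, r) \<in> P \<Longrightarrow> blinfun_apply f u \<le> r"
proof -
  define Q where "Q = (\<lambda>x. {s * r |s u r. s > 0 \<and> (u, r) \<in> P \<and> s *\<^sub>R u = x})"
  define q where "q = (\<lambda>x. Inf (Q x))"
  \<comment> \<open>The factor 2 leaves room for the strict inequality in \<open>Q_bound\<close> at
    \<open>s = 2 * norm x / \<rho>\<close>.\<close>
  define K where "K = 2 * M / \<rho>"
  have M: "M \<ge> 0" using nonneg ball[of 0] assms(2) by simp
  have Q_bound: "s * M \<in> Q x" if "s > 0" "norm x < s * \<rho>" for x s
  proof -
    have "norm ((1/s) *\<^sub>R x) < \<rho>" using that by (simp add: field_simps)
    from ball[OF this] show ?thesis using that(1) unfolding Q_def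
      by (intro CollectI exI[of _ s] exI[of _ "(1/s) *\<^sub>R x"] exI[of _ M]) simp
  qed
  have Q_add: "a + b \<in> Q (x + y)" if "a \<in> Q x" "b \<in> Q y" for a b x y
  proof -
    from that obtain s u r s' u' r' where
      1: "s > 0" "(u, r) \<in> P" "s *\<^sub>R u = x" "a = s * r" and
      2: "s' > 0" "(u', r') \<in> P" "s' *\<^sub>R u' = y" "b = s' * r'" unfolding Q_def by blast
    have "(s/(s+s')) *\<^sub>R (u, r) + (s'/(s+s')) *\<^sub>R (u', r') \<in> P"
      using 1 2 by (intro convexD[OF assms(1)]) (auto simp: add_divide_distrib[symmetric])
    moreover have "(s+s') *\<^sub>R ((s/(s+s')) *\<^sub>R u + (s'/(s+s')) *\<^sub>R u') = x + y"
      using 1 2 by (simp add: scaleR_add_right)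
    moreover have "a + b = (s+s') * ((s/(s+s')) * r + (s'/(s+s')) * r')"
    proof -
      have "s + s' \<noteq> 0" using 1 2 by simp
      then show ?thesis by (simp add: distrib_left 1 2)
    qed
    ultimately show ?thesis using 1 2 unfolding Q_def
      by (intro CollectI exI[of _ "s+s'"] exI conjI) auto
  qed
  have Q_scale: "t * a \<in> Q (t *\<^sub>R x)" if at: "a \<in> Q x" "t > 0" for a t x
  proof -
    from at obtain s u r where "s > 0" "(u, r) \<in> P" "s *\<^sub>R u = x" "a = s * r"
      unfolding Q_def by blast
    then show ?thesis using at(2) unfolding Q_def
      by (intro CollectI exI[of _ "t * s"] exI[of _ u] exI[of _ r]) auto
  qed
  have Q0: "a \<ge> 0" if "a \<in> Q 0" for a
  proof -
    from that obtain s u r where "s > 0" "(u, r) \<in> P" "s *\<^sub>R u = 0" "a = s * r"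
      unfolding Q_def by blast
    with nonneg[of r] show ?thesis by simp
  qed
  have ne: "Q x \<noteq> {}" for x
  proof -
    have "norm x < (norm x / \<rho> + 1) * \<rho>" using assms(2) by (simp add: field_simps)
    with Q_bound[of "norm x / \<rho> + 1" x] assms(2) show ?thesis by (force intro: add_nonneg_pos)
  qed
  have bdd: "bdd_below (Q x)" for x
  proof -
    obtain b where b: "b \<in> Q (- x)" using ne by blast
    \<comment> \<open>The sum \<open>a + b\<close> lies in \<open>Q 0\<close>, whose elements are
      nonnegative.\<close>
    have "- b \<le> a" if "a \<in> Q x" for a using Q0[of "a + b"] Q_add[OF that b] by simp
    then show ?thesis by (rule bdd_belowI)
  qed
  have "sublinear q" unfolding q_def
  proof (rule sublinearI)
    fix x y
    have "Inf (Q (x + y)) - a \<le> Inf (Q y)" if "a \<in> Q x" for a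
      using that by (intro cInf_greatest ne) (use cInf_lower[OF Q_add bdd] in force)
    then have "Inf (Q (x + y)) - Inf (Q y) \<le> Inf (Q x)"
      by (intro cInf_greatest ne) (simp add: algebra_simps)
    then show "Inf (Q (x + y)) \<le> Inf (Q x) + Inf (Q y)" by simp
  next
    fix t :: real and x assume t: "t > 0"
    have "Inf (Q (t *\<^sub>R x)) / t \<le> Inf (Q x)"
      by (intro cInf_greatest ne)
        (use cInf_lower[OF Q_scale bdd] t in \<open>force simp: field_simps\<close>)
    then show "Inf (Q (t *\<^sub>R x)) \<le> t * Inf (Q x)" using t by (simp add: field_simps)
  qed
  then obtain f where f: "linear f" "\<And>x. f x \<le> q x" using hahn_banach_sublinear by blast
  have fK: "f x \<le> K * norm x" for x
  proof (cases "x = 0")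
    case True
    then show ?thesis using linear_0[OF f(1)] by simp
  next
    case False
    have "2 * norm x / \<rho> * M \<in> Q x" using False assms(2) by (intro Q_bound) auto
    then have "q x \<le> 2 * norm x / \<rho> * M" unfolding q_def by (rule cInf_lower[OF _ bdd])
    then show ?thesis using f(2)[of x] by (simp add: K_def mult_ac)
  qed
  have "bounded_linear f"
  proof (rule bounded_linear_intro[where K = K])
    fix x
    have "- f x \<le> K * norm x" using fK[of "- x"] by (simp add: linear_neg[OF f(1)])
    with fK[of x] show "norm (f x) \<le> norm x * K" by (simp add: mult.commute abs_le_iff)
  qed (use f(1) in \<open>auto simp: linear_add linear_scale\<close>)
  moreover have "f u \<le> r" if "(u, r) \<in> P" for u r
  proof -
    have "1 * r \<in> Q u" using that unfolding Q_def
      by (intro CollectI exI[of _ 1] exI[of _ u] exI[of _ r]) simp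
    then have "q u \<le> r" unfolding q_def using cInf_lower[OF _ bdd] by force
    with f(2)[of u] show ?thesis by simp
  qed
  ultimately show ?thesis by (intro that[of "Blinfun f"]) (simp add: bounded_linear_Blinfun_apply)
qed

text \<open>Apply the minorant theorem to
  \<open>v(u) = inf {norm (c - y - u) - d | c \<in> C}\<close> with \<open>d\<close> the distance
  from \<open>y\<close> to \<open>C\<close>: then \<open>v 0 \<ge> 0\<close>, while
  \<open>v(c - y) \<le> - d\<close> for each \<open>c\<close> in \<open>C\<close>.\<close>

theorem separate_point_closed_convex:
  fixes C :: "'a::real_normed_vector set"
  assumes "convex C" "closed C" "C \<noteq> {}" "y \<notin> C"
  obtains f :: "'a \<Rightarrow>\<^sub>L real" and d where "d > 0" "\<And>c. c \<in> C \<Longrightarrow> blinfun_apply f c \<le> blinfun_apply f y - d"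
proof -
  define d where "d = infdist y C"
  have d: "d > 0" "\<And>c. c \<in> C \<Longrightarrow> d \<le> dist y c"
    using in_closed_iff_infdist_zero[OF assms(2,3), of y] assms(4) infdist_nonneg[of y C]
    by (auto simp: d_def intro: infdist_le)
  obtain c0 where c0: "c0 \<in> C" using assms(3) by blast
  define P where "P = {(u, r). \<exists>c\<in>C. norm (c - y - u) - d \<le> r}"
  have "convex P"
  proof (rule convexI)
    fix p p' and a b :: real
    assume "p \<in> P" "p' \<in> P" and ab: "0 \<le> a" "0 \<le> b" "a + b = 1"
    then obtain u r c u' r' c' where p: "p = (u, r)" "c \<in> C" "norm (c - y - u) - d \<le> r"
      and p': "p' = (u', r')" "c' \<in> C" "norm (c' - y - u') - d \<le> r'" unfolding P_def by auto
    have b: "b = 1 - a" using ab by simp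
    have "a *\<^sub>R c + b *\<^sub>R c' - y - (a *\<^sub>R u + b *\<^sub>R u') = a *\<^sub>R (c - y - u) + b *\<^sub>R (c' - y - u')"
      by (simp add: b algebra_simps)
    then have "norm (a *\<^sub>R c + b *\<^sub>R c' - y - (a *\<^sub>R u + b *\<^sub>R u'))
      \<le> a * norm (c - y - u) + b * norm (c' - y - u')"
      using ab by (metis norm_triangle_le norm_scaleR abs_of_nonneg order_refl)
    moreover have "a * (norm (c - y - u) - d) + b * (norm (c' - y - u') - d) \<le> a * r + b * r'"
      using p p' ab by (intro add_mono mult_left_mono)
    ultimately have "norm (a *\<^sub>R c + b *\<^sub>R c' - y - (a *\<^sub>R u + b *\<^sub>R u')) - d \<le> a * r + b * r'"
      by (simp add: b algebra_simps)
    moreover have "a *\<^sub>R c + b *\<^sub>R c' \<in> C" using p p' ab by (intro convexD[OF assms(1)])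
    ultimately show "a *\<^sub>R p + b *\<^sub>R p' \<in> P" unfolding P_def p p' by auto
  qed
  moreover have "(u, norm (c0 - y) + 1) \<in> P" if "norm u < 1" for u
    unfolding P_def using c0 d(1) that norm_triangle_ineq4[of "c0 - y" u] by force
  moreover have "0 \<le> r" if "(0, r) \<in> P" for r
    using that d(2) unfolding P_def by (force simp: dist_norm norm_minus_commute)
  ultimately obtain f :: "'a \<Rightarrow>\<^sub>L real" where f: "\<And>u r. (u, r) \<in> P \<Longrightarrow> blinfun_apply f u \<le> r"
    using convex_epigraph_affine_minorant[of P 1] by (metis zero_less_one)
  have "blinfun_apply f c \<le> blinfun_apply f y - d" if "c \<in> C" for c
  proof -
    have "(c - y, - d) \<in> P" unfolding P_def using that by force
    from f[OF this] show ?thesis by (simp add: blinfun.diff_right)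
  qed
  with d(1) show ?thesis by (rule that)
qed

subsection \<open>Convex images and the Baire property\<close>

text \<open>The weights \<open>(1/2) ^ Suc k\<close> sum to 1, so the series is an infinite convex
  combination.\<close>

lemma convex_series_mem:
  fixes e :: "nat \<Rightarrow> 'e::banach"
  assumes "convex K" "closed K" "bounded K" and e: "\<And>k. e k \<in> K"
  shows "summable (\<lambda>k. (1/2) ^ Suc k *\<^sub>R e k)" "(\<Sum>k. (1/2) ^ Suc k *\<^sub>R e k) \<in> K"
proof -
  obtain M where M: "\<And>x. x \<in> K \<Longrightarrow> norm x \<le> M" using assms(3) by (auto simp: bounded_iff)
  show sm: "summable (\<lambda>k. (1/2) ^ Suc k *\<^sub>R e k)"
  proof (rule summable_comparison_test')
    show "summable (\<lambda>k. (1/2) ^ Suc k * M)"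
      using sums_summable[OF power_half_series] by (intro summable_mult2)
    show "norm ((1/2) ^ Suc k *\<^sub>R e k) \<le> (1/2) ^ Suc k * M" for k
      using M[OF e] by (simp add: mult_left_mono)
  qed
  \<comment> \<open>The first \<open>m\<close> weights leave the mass \<open>(1/2) ^ m\<close>;
    placing it on \<open>e 0\<close> gives a genuine convex combination with the same limit.\<close>
  have part: "(\<Sum>k<m. (1/2) ^ Suc k *\<^sub>R e k) + (1/2) ^ m *\<^sub>R e 0 \<in> K" for m
  proof -
    have "(\<Sum>k<m. (1/2) ^ Suc k *\<^sub>R e k) + (1/2) ^ m *\<^sub>R z \<in> K" if "z \<in> K" for z
      using that
    proof (induction m arbitrary: z)
      case (Suc m)
      have "(1/2) *\<^sub>R e m + (1/2) *\<^sub>R z \<in> K" using Suc.prems e by (intro convexD[OF assms(1)]) auto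
      from Suc.IH[OF this] show ?case by (simp add: scaleR_add_right add.assoc)
    qed simp
    then show ?thesis using e by blast
  qed
  have "(\<lambda>m. (\<Sum>k<m. (1/2) ^ Suc k *\<^sub>R e k) + (1/2) ^ m *\<^sub>R e 0)
      \<longlonglongrightarrow> (\<Sum>k. (1/2) ^ Suc k *\<^sub>R e k) + 0 *\<^sub>R e 0"
    by (intro tendsto_intros summable_LIMSEQ sm LIMSEQ_power_zero) simp
  then show "(\<Sum>k. (1/2) ^ Suc k *\<^sub>R e k) \<in> K"
    using closed_sequentially[OF assms(2) part] by (simp only: scaleR_zero_left add_0_right)
qed

text \<open>The successive approximation of the open mapping theorem, with convex weights
  \<open>(1/2) ^ Suc k\<close> so that the constructed preimage stays in \<open>K\<close>. Halving
  the radius pays for removing the closure.\<close>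

lemma ball_subset_convex_image:
  fixes T :: "'e::banach \<Rightarrow> 'y::real_normed_vector"
  assumes T: "bounded_linear T" and K: "convex K" "closed K" "bounded K"
    and "\<rho> > 0" and cl: "ball w \<rho> \<subseteq> closure (T ` K)"
  shows "ball w (\<rho> / 2) \<subseteq> T ` K"
proof
  fix u assume "u \<in> ball w (\<rho> / 2)"
  then have u: "norm (u - w) < \<rho> / 2" by (simp add: dist_norm norm_minus_commute)
  \<comment> \<open>Doubling \<open>r\<close> stays within radius \<open>\<rho>\<close>, and the new
    error is again below \<open>\<rho> / 2\<close>, so the step can be iterated.\<close>
  have ex: "\<exists>e\<in>K. norm (2 *\<^sub>R r + w - T e) < \<rho> / 2" if "norm r < \<rho> / 2" for r
  proof -
    have "2 *\<^sub>R r + w \<in> closure (T ` K)" using that cl by (auto simp: dist_norm)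
    with assms(5) obtain e where "e \<in> K" "dist (T e) (2 *\<^sub>R r + w) < \<rho> / 2"
      unfolding closure_approachable by (metis half_gt_zero imageE)
    then show ?thesis by (auto simp: dist_norm norm_minus_commute)
  qed
  then obtain c where c: "\<And>r. norm r < \<rho> / 2 \<Longrightarrow> c r \<in> K \<and> norm (2 *\<^sub>R r + w - T (c r)) < \<rho> / 2"
    by metis
  \<comment> \<open>Rescaled remainders: \<open>r k = 2 ^ k *\<^sub>R (u - w - (\<Sum>j<k. (1/2) ^ Suc j *\<^sub>R (T (c (r j)) - w)))\<close>.\<close>
  define r where "r = rec_nat (u - w) (\<lambda>_ r. 2 *\<^sub>R r + w - T (c r))"
  have r0: "r 0 = u - w" and rS: "r (Suc k) = 2 *\<^sub>R r k + w - T (c (r k))" for k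
    by (simp_all add: r_def)
  have rn: "norm (r k) < \<rho> / 2" for k
    by (induction k) (use u c in \<open>simp_all add: r0 rS\<close>)
  have cK: "c (r k) \<in> K" for k using c[OF rn] by blast
  have eq: "T (\<Sum>k<m. (1/2) ^ Suc k *\<^sub>R c (r k)) = u - (1/2) ^ m *\<^sub>R (w + r m)" for m
  proof (induction m)
    case 0
    show ?case by (simp add: r0 linear_0[OF bounded_linear.linear[OF T]])
  next
    case (Suc m)
    have "T (\<Sum>k<Suc m. (1/2) ^ Suc k *\<^sub>R c (r k))
      = u - (1/2) ^ m *\<^sub>R (w + r m) + (1/2) ^ Suc m *\<^sub>R T (c (r m))"
      using T Suc.IH by (simp add: bounded_linear.linear linear_add linear_scale)
    also have "T (c (r m)) = 2 *\<^sub>R r m + w - r (Suc m)" by (simp add: rS)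
    also have "u - (1/2) ^ m *\<^sub>R (w + r m) + (1/2) ^ Suc m *\<^sub>R (2 *\<^sub>R r m + w - r (Suc m))
      = u - (1/2) ^ Suc m *\<^sub>R (w + r (Suc m))"
      by (simp add: algebra_simps) (simp flip: scaleR_add_left)
    finally show ?case .
  qed
  let ?e = "\<Sum>k. (1/2) ^ Suc k *\<^sub>R c (r k)"
  note ser = convex_series_mem[OF K, of "\<lambda>k. c (r k)", OF cK]
  have "(\<lambda>m. (1/2) ^ m *\<^sub>R (w + r m)) \<longlonglongrightarrow> 0"
  proof (rule Lim_null_comparison)
    have "norm (w + r m) \<le> norm w + \<rho> / 2" for m
      using rn[of m] norm_triangle_ineq[of w "r m"] by linarith
    then show "\<forall>\<^sub>F m in sequentially. norm ((1/2) ^ m *\<^sub>R (w + r m)) \<le> (1/2) ^ m * (norm w + \<rho> / 2)"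
      by (intro always_eventually) (simp add: mult_left_mono del: power_divide)
    show "(\<lambda>m. (1/2) ^ m * (norm w + \<rho> / 2)) \<longlonglongrightarrow> 0"
      by (intro tendsto_mult_left_zero LIMSEQ_power_zero) simp
  qed
  then have "(\<lambda>m. u - (1/2) ^ m *\<^sub>R (w + r m)) \<longlonglongrightarrow> u - 0" by (intro tendsto_diff tendsto_const)
  then have "(\<lambda>m. T (\<Sum>k<m. (1/2) ^ Suc k *\<^sub>R c (r k))) \<longlonglongrightarrow> u" unfolding eq by simp
  moreover have "(\<lambda>m. T (\<Sum>k<m. (1/2) ^ Suc k *\<^sub>R c (r k))) \<longlonglongrightarrow> T ?e"
    by (intro bounded_linear.tendsto[OF T] summable_LIMSEQ ser)
  ultimately have "u = T ?e" by (rule LIMSEQ_unique)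
  then show "u \<in> T ` K" using ser(2) by blast
qed

lemma Baire_union_interior:
  fixes A :: "nat \<Rightarrow> 'y::{complete_space, metric_space} set"
  assumes "\<And>n. closed (A n)" "(\<Union>n. A n) = UNIV"
  obtains n where "interior (A n) \<noteq> {}"
proof (rule ccontr)
  assume "\<not> thesis"
  then have "interior (A n) = {}" for n using that by blast
  then have "Met_TC.mtopology interior_of \<Union>(range A) = ({} :: 'y set)"
    using assms(1) by (intro Met_TC.metric_Baire_category_alt) auto
  then show False using assms(2) by simp
qed

theorem absorbing_convex_image_contains_ball:
  fixes T :: "'e::banach \<Rightarrow> 'y::banach"
  assumes T: "bounded_linear T"
    and K: "\<And>n. convex (K n)" "\<And>n. closed (K n)" "\<And>n. bounded (K n)" "incseq K"
    and absorb: "\<And>v. \<exists>t>0. \<exists>n. w + t *\<^sub>R v \<in> T ` K n"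
  obtains n \<rho> where "\<rho> > 0" "ball w \<rho> \<subseteq> T ` K n"
proof -
  have lin: "linear T" using T by (rule bounded_linear.linear)
  have cK: "convex (T ` K n)" for n using K(1) lin by (rule convex_linear_image[rotated])
  have mono: "T ` K m \<subseteq> T ` K n" if "m \<le> n" for m n
    using K(4) that by (auto simp: incseq_def)
  obtain n0 where n0: "w \<in> T ` K n0" using absorb[of 0] by auto
  define A where "A = (\<lambda>n. (\<lambda>u. w + (1 / (real n + 1)) *\<^sub>R u) -` closure (T ` K n))"
  have "closed (A n)" for n
    unfolding A_def by (intro closed_vimage closed_closure continuous_intros)
  moreover have "(\<Union>n. A n) = UNIV"
  proof -
    have "\<exists>n. v \<in> A n" for v
    proof -
      obtain t n where t: "t > 0" "w + t *\<^sub>R v \<in> T ` K n" using absorb by blast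
      define m where "m = max (max n n0) (nat \<lceil>1/t\<rceil>)"
      have m: "n \<le> m" "n0 \<le> m" "1/t \<le> real m + 1" unfolding m_def by linarith+
      define s where "s = 1 / (t * (real m + 1))"
      have s: "0 \<le> s" "s \<le> 1" using t(1) m(3) by (auto simp: s_def field_simps)
      have "(1 - s) *\<^sub>R w + s *\<^sub>R (w + t *\<^sub>R v) \<in> T ` K m"
        using s t(2) n0 mono[OF m(1)] mono[OF m(2)] by (intro convexD[OF cK]) auto
      also have "(1 - s) *\<^sub>R w + s *\<^sub>R (w + t *\<^sub>R v) = w + (1 / (real m + 1)) *\<^sub>R v"
      proof -
        have "s * t = 1 / (real m + 1)" using t(1) by (simp add: s_def)
        then show ?thesis by (simp add: algebra_simps)
      qed
      finally have "w + (1 / (real m + 1)) *\<^sub>R v \<in> closure (T ` K m)"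
        by (rule closure_subset[THEN subsetD])
      then show ?thesis unfolding A_def by (intro exI vimageI2)
    qed
    then show ?thesis by blast
  qed
  ultimately obtain m where "interior (A m) \<noteq> {}" by (rule Baire_union_interior)
  then obtain a where "a \<in> interior (A m)" by blast
  then obtain r where r: "r > 0" "ball a r \<subseteq> A m" unfolding mem_interior by blast
  \<comment> \<open>The opposite direction \<open>- a\<close> supplies the point that balances
    \<open>w + c a\<close>.\<close>
  obtain t k where t: "t > 0" "w + t *\<^sub>R (- a) \<in> T ` K k" using absorb by blast
  define N where "N = max m k"
  define D where "D = closure (T ` K N)"
  have D: "convex D" unfolding D_def by (intro convex_closure cK)
  have neg: "w - t *\<^sub>R a \<in> D"
    using t(2) mono[of k N] closure_subset unfolding D_def N_def by fastforce
  define c where "c = 1 / (real m + 1)"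
  have c: "c > 0" by (simp add: c_def)
  \<comment> \<open>The ball around \<open>w + c a\<close> has radius \<open>c r\<close>; weighting
    it with \<open>t / (t + c)\<close> leaves this radius.\<close>
  define \<rho> where "\<rho> = t * c * r / (t + c)"
  have \<rho>: "\<rho> > 0" using t(1) c r(1) by (simp add: \<rho>_def)
  have "ball w \<rho> \<subseteq> D"
  proof
    fix u assume "u \<in> ball w \<rho>"
    then have u: "norm (u - w) < \<rho>" by (simp add: dist_norm norm_minus_commute)
    let ?z = "((t + c) / (t * c)) *\<^sub>R (u - w)"
    have "norm ?z = (t + c) / (t * c) * norm (u - w)" using t(1) c by simp
    also have "\<dots> < r" using u t(1) c by (simp add: \<rho>_def field_simps)
    finally have "norm ?z < r" .
    then have "a + ?z \<in> A m" using r(2) by (auto simp: dist_norm)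
    then have pos: "w + c *\<^sub>R (a + ?z) \<in> D"
      using closure_mono[OF mono[of m N]] by (auto simp: A_def D_def N_def c_def)
    \<comment> \<open>The weights are chosen so that the contributions of \<open>a\<close> cancel,
      \<open>\<alpha> * c = \<beta> * t\<close>.\<close>
    define \<alpha> \<beta> \<gamma> where "\<alpha> = t / (t + c)" and "\<beta> = c / (t + c)" and "\<gamma> = (t + c) / (t * c)"
    have nz: "t + c \<noteq> 0" using t(1) c by linarith
    have sum1: "\<alpha> + \<beta> = 1" unfolding \<alpha>_def \<beta>_def using nz by (simp add: add_divide_distrib[symmetric])
    have coeff: "\<alpha> * c = \<beta> * t" "\<alpha> * c * \<gamma> = 1"
      using nz t(1) c by (simp_all add: \<alpha>_def \<beta>_def \<gamma>_def)
    have "\<alpha> *\<^sub>R (w + c *\<^sub>R (a + ?z)) + \<beta> *\<^sub>R (w - t *\<^sub>R a) \<in> D"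
      using t(1) c sum1 by (intro convexD[OF D pos neg]) (auto simp: \<alpha>_def \<beta>_def)
    also have "\<alpha> *\<^sub>R (w + c *\<^sub>R (a + ?z)) + \<beta> *\<^sub>R (w - t *\<^sub>R a)
      = (\<alpha> + \<beta>) *\<^sub>R w + (\<alpha> * c - \<beta> * t) *\<^sub>R a + (\<alpha> * c * \<gamma>) *\<^sub>R (u - w)"
      unfolding \<gamma>_def[symmetric] by (simp add: algebra_simps)
    also have "\<dots> = u" unfolding sum1 coeff(2) by (simp add: coeff(1))
    finally show "u \<in> D" .
  qed
  then have "ball w (\<rho> / 2) \<subseteq> T ` K N"
    unfolding D_def by (intro ball_subset_convex_image[OF T K(1-3) \<rho>])
  with \<rho> show ?thesis by (intro that[of "\<rho> / 2"]) auto
qed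

subsection \<open>Cycles as lists\<close>

definition gap :: "'a::real_normed_vector \<times> 'a dual \<Rightarrow> 'a \<times> 'a dual \<Rightarrow> real" where
  "gap a b = blinfun_apply (snd a) (fst b - fst a)"

text \<open>An open path. A cycle \<open>l\<close> is written \<open>l @ [hd l]\<close>, so that
  cutting and rotating cycles become list operations.\<close>

fun path_gap :: "('a::real_normed_vector \<times> 'a dual) list \<Rightarrow> real" where
  "path_gap (a # b # l) = gap a b + path_gap (b # l)"
| "path_gap l = 0"

lemma gap_self [simp]: "gap a a = 0"
  by (simp add: gap_def)

lemma path_gap_split: "path_gap (k @ a # l) = path_gap (k @ [a]) + path_gap (a # l)"
  by (induction k rule: path_gap.induct) (cases l, auto)

lemma path_gap_snoc: "l \<noteq> [] \<Longrightarrow> path_gap (l @ [b]) = path_gap l + gap (last l) b"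
  using path_gap_split[of "butlast l" "last l" "[b]"]
  by (metis append_butlast_last_id append_Cons append_Nil append_assoc path_gap.simps(1,3) add_0_right)

text \<open>Repeating a point costs nothing, which allows a short chain to be padded to a prescribed
  length.\<close>

lemma path_gap_replicate: "path_gap (a # replicate m a @ [b]) = gap a b"
  by (induction m) auto

lemma path_gap_upt:
  assumes "i \<le> j"
  shows "path_gap (map s [i..<Suc j]) = (\<Sum>k=i..<j. gap (s k) (s (Suc k)))"
  using assms
proof (induction j rule: dec_induct)
  case (step m)
  have "path_gap (map s [i..<m] @ s m # [s (Suc m)]) = path_gap (map s [i..<Suc m]) + gap (s m) (s (Suc m))"
    using step.hyps by (subst path_gap_split) simp
  then show ?case using step by simp
qed simp

lemma path_gap_nth_sum:
  "path_gap l = (\<Sum>k=1..<length l. gap (l ! (k - 1)) (l ! k))"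
proof (cases "l = []")
  case False
  then have "map (\<lambda>k. l ! (k - 1)) [1..<Suc (length l)] = l"
    by (intro nth_equalityI) (simp_all del: upt_Suc)
  with path_gap_upt[of 1 "length l" "\<lambda>k. l ! (k - 1)"] False show ?thesis
    by (simp add: Suc_le_eq del: upt_Suc)
qed simp

lemma n_monotone_set_list_iff:
  assumes "n \<ge> 1"
  shows "n_monotone_set n G \<longleftrightarrow> (\<forall>l. length l = n \<and> set l \<subseteq> G \<longrightarrow> path_gap (l @ [hd l]) \<le> 0)"
proof (intro iffI allI impI)
  fix l assume "n_monotone_set n G" "length l = n \<and> set l \<subseteq> G"
  then have G: "n_monotone_set n G" "set l \<subseteq> G" "n = length l" by auto
  \<comment> \<open>Positions shift by one, since \<open>n_monotone_set\<close> counts from 1; the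
    value at \<open>n + 1\<close> is the repeated head.\<close>
  define s where "s = (\<lambda>i. (l @ [hd l]) ! (i - 1))"
  have "path_gap (l @ [hd l]) = (\<Sum>i=1..n. gap (s i) (s (i + 1)))"
    unfolding path_gap_nth_sum s_def G(3) by (intro sum.cong) auto
  also have "\<dots> \<le> 0"
  proof -
    have "s i \<in> G" if "i \<in> {1..n}" for i
    proof -
      have "l ! (i - 1) \<in> set l" using that G(3) by (intro nth_mem) auto
      then show ?thesis using that G by (auto simp: s_def nth_append)
    qed
    moreover have "s (n + 1) = s 1" using assms G(3) by (cases l) (auto simp: s_def nth_append)
    ultimately show ?thesis using G(1) unfolding n_monotone_set_def gap_def by blast
  qed
  finally show "path_gap (l @ [hd l]) \<le> 0" .
next
  assume R: "\<forall>l. length l = n \<and> set l \<subseteq> G \<longrightarrow> path_gap (l @ [hd l]) \<le> 0"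
  show "n_monotone_set n G"
    unfolding n_monotone_set_def
  proof (intro allI impI)
    fix s assume s: "(\<forall>i\<in>{1..n}. s i \<in> G) \<and> s (n + 1) = s 1"
    let ?l = "map s [1..<Suc n]"
    have "length ?l = n" "set ?l \<subseteq> G" using s by auto
    then have "path_gap (?l @ [hd ?l]) \<le> 0" using R by blast
    moreover have "?l @ [hd ?l] = map s [1..<Suc (Suc n)]"
    proof -
      have "hd ?l = s 1" using assms by (simp add: hd_map del: upt_Suc)
      then show ?thesis using s by simp
    qed
    ultimately have "(\<Sum>k=1..<Suc n. gap (s k) (s (Suc k))) \<le> 0"
      using path_gap_upt[of 1 "Suc n" s] by simp
    then show "(\<Sum>i=1..n. blinfun_apply (snd (s i)) (fst (s (i + 1)) - fst (s i))) \<le> 0"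
      by (simp add: gap_def atLeastLessThanSuc_atLeastAtMost)
  qed
qed

text \<open>The hypothesis \<open>chain\<close> treats cycles in which \<open>p\<close> occurs once
  among \<open>n\<close> points. Several occurrences of \<open>p\<close> cut the cycle into shorter
  loops, which are padded to full length; a cycle avoiding \<open>p\<close> lies in
  \<open>G\<close>.\<close>

lemma n_monotone_set_insert:
  assumes "n \<ge> 2" and G: "n_monotone_set n G"
    and chain: "\<And>l. length l = n - 1 \<Longrightarrow> set l \<subseteq> G \<Longrightarrow> path_gap (l @ [p]) + gap p (hd l) \<le> 0"
  shows "n_monotone_set n ({p} \<union> G)"
proof -
  have loop: "path_gap (p # l @ [p]) \<le> 0" if "length l \<le> n - 1" "set l \<subseteq> {p} \<union> G" for l
    using that
  proof (induction l rule: length_induct)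
    case (1 l)
    consider "l = []" | "l \<noteq> []" "p \<notin> set l" | "p \<in> set l" by blast
    then show ?case
    proof cases
      case 2
      then obtain h t where l: "l = h # t" by (cases l) auto
      \<comment> \<open>Number of extra copies of the last point needed to reach length
        \<open>n - 1\<close>.\<close>
      let ?m = "n - 1 - length l"
      let ?k = "butlast l @ replicate (Suc ?m) (last l)"
      have ls: "butlast l @ [last l] = l" using 2 by simp
      have "path_gap (?k @ [p]) = path_gap (butlast l @ last l # replicate ?m (last l) @ [p])" by simp
      also have "\<dots> = path_gap l + path_gap (last l # replicate ?m (last l) @ [p])"
        by (subst path_gap_split) (simp add: ls)
      also have "path_gap (last l # replicate ?m (last l) @ [p]) = gap (last l) p"
        by (rule path_gap_replicate)
      also have "path_gap l + gap (last l) p = path_gap (l @ [p])"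
        by (simp add: path_gap_snoc 2(1))
      finally have "path_gap (?k @ [p]) = path_gap (l @ [p])" .
      moreover have "length ?k = n - 1"
      proof -
        have "length ?k = length l - 1 + Suc ?m" by simp
        moreover have "1 \<le> length l" by (simp add: l)
        ultimately show ?thesis using 1(2) by linarith
      qed
      moreover have "set ?k \<subseteq> G" 
        using 1(3) 2 last_in_set[OF 2(1)] by (auto dest: in_set_butlastD simp del: last_in_set)
      moreover have "hd ?k = h" by (cases t) (auto simp: l)
      ultimately have "path_gap (l @ [p]) + gap p h \<le> 0" using chain[of ?k] by metis
      then show ?thesis by (simp add: l)
    next
      case 3
      then obtain a b where l: "l = a @ p # b" by (meson split_list)
      have "path_gap (p # l @ [p]) = path_gap (p # a @ [p]) + path_gap (p # b @ [p])"
        using path_gap_split[of "p # a" p "b @ [p]"] by (simp add: l)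
      moreover have "path_gap (p # a @ [p]) \<le> 0" "path_gap (p # b @ [p]) \<le> 0"
        using 1 by (auto simp: l)
      ultimately show ?thesis by simp
    qed simp
  qed
  have "path_gap (l @ [hd l]) \<le> 0" if l: "length l = n" "set l \<subseteq> {p} \<union> G" for l
  proof (cases "p \<in> set l")
    case False
    then show ?thesis using l G n_monotone_set_list_iff[of n G] assms(1) by auto
  next
    case True
    then obtain a b where ab: "l = a @ p # b" by (meson split_list)
    show ?thesis
    proof (cases a)
      case Nil
      then show ?thesis using loop[of b] l by (auto simp: ab)
    next
      case (Cons h t)
      \<comment> \<open>rotate the cycle so that it starts at \<open>p\<close>\<close>
      have "path_gap (l @ [hd l]) = path_gap (h # t @ [p]) + path_gap (p # b @ [h])"
        using path_gap_split[of a p "b @ [h]"] by (simp add: ab Cons)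
      also have "\<dots> = path_gap (p # (b @ h # t) @ [p])"
        using path_gap_split[of "p # b" h "t @ [p]"] by simp
      also have "\<dots> \<le> 0" using l by (intro loop) (auto simp: ab Cons)
      finally show ?thesis .
    qed
  qed
  then show ?thesis using n_monotone_set_list_iff[of n "{p} \<union> G"] assms(1) by auto
qed

subsection \<open>Fenchel duality\<close>

text \<open>Real upper bounds \<open>c\<close> of \<open>v\<close> encode the infinite cases:
  \<open>v = \<infinity>\<close> has none, and \<open>v = -\<infinity>\<close> has all, making both
  sides false.\<close>

lemma ereal_minus_le_iff_real:
  "ereal k - v \<le> ereal a \<longleftrightarrow> (\<forall>c. v \<le> ereal c \<longrightarrow> k - c \<le> a)"
proof (cases v)
  case (real r)
  then show ?thesis by (auto intro: order_trans[OF diff_left_mono])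
next
  case MInf
  then show ?thesis by simp (rule exI[of _ "k - a - 1"], simp)
qed auto

text \<open>A sublevel set becomes an intersection of conditions that are affine and continuous in
  \<open>(xs, x)\<close>; convexity and closedness are read off from this form.\<close>

lemma fenchel_conjugate_le_iff:
  "fenchel_conjugate f (xs, x) \<le> ereal a
    \<longleftrightarrow> (\<forall>y ys c. f (y, ys) \<le> ereal c \<longrightarrow> blinfun_apply xs y + blinfun_apply ys x - c \<le> a)"
  unfolding fenchel_conjugate_def by (auto simp: SUP_le_iff ereal_minus_le_iff_real)

lemma fenchel_conjugate_convex:
  assumes "fenchel_conjugate f (xs, x) \<le> ereal a" "fenchel_conjugate f (xs', x') \<le> ereal a'"
    and "0 \<le> s" "0 \<le> t" "s + t = 1"
  shows "fenchel_conjugate f (s *\<^sub>R xs + t *\<^sub>R xs', s *\<^sub>R x + t *\<^sub>R x') \<le> ereal (s * a + t * a')"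
  unfolding fenchel_conjugate_le_iff
proof (intro allI impI)
  fix y ys c assume "f (y, ys) \<le> ereal c"
  then have "s * (blinfun_apply xs y + blinfun_apply ys x - c) \<le> s * a"
    "t * (blinfun_apply xs' y + blinfun_apply ys x' - c) \<le> t * a'"
    using assms by (auto simp: fenchel_conjugate_le_iff intro!: mult_left_mono)
  moreover have "c = s * c + t * c" using assms(5) by (simp flip: distrib_right)
  ultimately show "blinfun_apply (s *\<^sub>R xs + t *\<^sub>R xs') y + blinfun_apply ys (s *\<^sub>R x + t *\<^sub>R x') - c
      \<le> s * a + t * a'"
    by (simp add: blinfun.bilinear_simps right_diff_distrib distrib_left)
qed

lemma barrier_cone_iff:
  "b \<in> barrier_cone C \<longleftrightarrow> (\<exists>k. \<forall>c\<in>C. blinfun_apply b c \<le> k)"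
proof
  assume "b \<in> barrier_cone C"
  then have "(SUP x\<in>C. ereal (blinfun_apply b x)) \<noteq> \<infinity>"
    by (simp add: barrier_cone_def effective_domain_def support_function_def)
  then obtain k :: nat where "(SUP x\<in>C. ereal (blinfun_apply b x)) \<le> ereal (real k)"
    unfolding less_PInf_Ex_of_nat by (auto intro: less_imp_le)
  then show "\<exists>k. \<forall>c\<in>C. blinfun_apply b c \<le> k" by (auto simp: SUP_le_iff)
next
  assume "\<exists>k. \<forall>c\<in>C. blinfun_apply b c \<le> k"
  then obtain k where "(SUP x\<in>C. ereal (blinfun_apply b x)) \<le> ereal k" by (auto simp: SUP_le_iff)
  also have "\<dots> < \<infinity>" by simp
  finally show "b \<in> barrier_cone C"
    by (simp add: barrier_cone_def effective_domain_def support_function_def)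
qed

lemma halfspace_closure_convex_hull:
  fixes b :: "'a::real_normed_vector dual"
  assumes "\<And>c. c \<in> D \<Longrightarrow> blinfun_apply b c \<le> k" "c \<in> closure (convex hull D)"
  shows "blinfun_apply b c \<le> k"
proof -
  have "closed {c. blinfun_apply b c \<le> k}"
    by (intro closed_Collect_le continuous_intros)
  moreover have "convex {c. blinfun_apply b c \<le> k}"
    using convex_linear_vimage[of "blinfun_apply b" "{..k}"]
    by (simp add: vimage_def bounded_linear.linear blinfun.bounded_linear_right)
  ultimately have "closure (convex hull D) \<subseteq> {c. blinfun_apply b c \<le> k}"
    using assms(1) by (intro closure_minimal hull_minimal) auto
  with assms(2) show ?thesis by blast
qed

text \<open>A bound for a continuous linear functional on \<open>D\<close> persists on the closed
  convex hull.\<close>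

lemma barrier_cone_closure_convex_hull:
  "barrier_cone D \<subseteq> barrier_cone (closure (convex hull D))"
  using halfspace_closure_convex_hull by (fastforce simp: barrier_cone_iff)

text \<open>The second conclusion bounds the conjugate of \<open>fenchel_conjugate f\<close> at
  \<open>(w - B y, y)\<close> by the duality product, phrased with real bounds \<open>a\<close>. The
  point \<open>y\<close> represents a linear minorant of the convex value function.\<close>

theorem fenchel_conjugate_duality:
  fixes B :: "'a::banach \<Rightarrow>\<^sub>L 'a dual" and f :: "'a \<times> 'a dual \<Rightarrow> ereal"
  assumes reflexive: "reflexive_space TYPE('a)"
    and C: "convex C" "closed C" "C \<noteq> {}"
    and B: "\<And>x. 0 \<le> blinfun_apply (blinfun_apply B x) x"
    and h_ge: "\<And>xs x. ereal (blinfun_apply xs x) \<le> fenchel_conjugate f (xs, x)"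
    and dom: "\<And>xs x. (xs, x) \<in> effective_domain (fenchel_conjugate f) \<Longrightarrow> x \<in> C"
    and w: "w \<in> core
            ({xs - blinfun_apply (blinfun_adjoint B) x | xs x.
                (xs, x) \<in> effective_domain (fenchel_conjugate f)}
             + range (blinfun_apply (B + blinfun_adjoint B)) + barrier_cone C)"
  obtains y where "y \<in> C"
    "\<And>xs x a. fenchel_conjugate f (xs, x) \<le> ereal a \<Longrightarrow>
      blinfun_apply xs y + blinfun_apply (w - blinfun_apply B y) x - a
        \<le> blinfun_apply (w - blinfun_apply B y) y"
proof -
  let ?h = "fenchel_conjugate f" and ?q = "\<lambda>x. blinfun_apply (blinfun_apply B x)"
  let ?Bs = "blinfun_apply (blinfun_adjoint B)"
  note bil = blinfun.bilinear_simps blinfun_adjoint_apply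
  \<comment> \<open>\<open>\<kappa> p b\<close> says that \<open>b\<close> is a real upper bound of
    the supremum, which avoids extended reals.\<close>
  define \<kappa> where "\<kappa> p b \<longleftrightarrow> (\<forall>c\<in>C. blinfun_apply p c - ?q c c \<le> b)" for p b
  have h_dom: "(xs, x) \<in> effective_domain ?h" if "?h (xs, x) \<le> ereal a" for xs x a
    using that by (auto simp: effective_domain_def intro: le_less_trans)
  have h_real: "\<exists>a. ?h (xs, x) \<le> ereal a" if "(xs, x) \<in> effective_domain ?h" for xs x
    using that by (cases "?h (xs, x)") (auto simp: effective_domain_def)
  \<comment> \<open>Expansion of the monotonicity inequality at \<open>c - z\<close>. It bounds the
    supremum for \<open>p = (B + blinfun_adjoint B) z\<close> by \<open>?q z z\<close>.\<close>
  have square: "?q z c + ?q c z - ?q c c \<le> ?q z z" for z c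
    using B[of "c - z"] by (simp add: bil)
  define T :: "'a dual \<times> 'a \<times> 'a dual \<Rightarrow> 'a dual" where
    "T = (\<lambda>e. fst e - ?Bs (fst (snd e)) + snd (snd e))"
  \<comment> \<open>Every triple \<open>(xs, x, p)\<close> with finite cost lies in some
    \<open>K n\<close>; the bounds on the conjugate and on \<open>\<kappa>\<close> later control the
    cost on a ball.\<close>
  define K where "K = (\<lambda>n::nat. {e. norm e \<le> real n \<and> ?h (fst e, fst (snd e)) \<le> ereal (real n)
    \<and> \<kappa> (snd (snd e)) (real n)})"
  have T: "bounded_linear T"
    unfolding T_def by (intro bounded_linear_intros)
  have "convex (K n)" for n
  proof (rule convexI)
    fix e e' and s t :: real
    assume e: "e \<in> K n" "e' \<in> K n" and st: "0 \<le> s" "0 \<le> t" "s + t = 1"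
    have nn: "s * real n + t * real n = real n" using st(3) by (simp flip: distrib_right)
    have "norm (s *\<^sub>R e + t *\<^sub>R e') \<le> s * norm e + t * norm e'"
      using st by (metis norm_triangle_ineq norm_scaleR abs_of_nonneg)
    also have "\<dots> \<le> s * real n + t * real n"
      using e st by (intro add_mono mult_left_mono) (auto simp: K_def)
    finally have "norm (s *\<^sub>R e + t *\<^sub>R e') \<le> real n" by (simp add: nn)
    moreover have "?h (s *\<^sub>R fst e + t *\<^sub>R fst e', s *\<^sub>R fst (snd e) + t *\<^sub>R fst (snd e')) \<le> ereal (real n)"
      using fenchel_conjugate_convex[of f _ _ n _ _ n, OF _ _ st] e unfolding nn K_def by blast
    moreover have "\<kappa> (s *\<^sub>R snd (snd e) + t *\<^sub>R snd (snd e')) (real n)"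
      unfolding \<kappa>_def
    proof
      fix c assume "c \<in> C"
      then have "s * (blinfun_apply (snd (snd e)) c - ?q c c) + t * (blinfun_apply (snd (snd e')) c - ?q c c)
          \<le> s * real n + t * real n"
        using e st by (intro add_mono mult_left_mono) (auto simp: K_def \<kappa>_def)
      moreover have "s * ?q c c + t * ?q c c = ?q c c" using st(3) by (simp flip: distrib_right)
      ultimately show "blinfun_apply (s *\<^sub>R snd (snd e) + t *\<^sub>R snd (snd e')) c - ?q c c \<le> real n"
        by (simp add: nn blinfun.bilinear_simps right_diff_distrib)
    qed
    ultimately show "s *\<^sub>R e + t *\<^sub>R e' \<in> K n" by (simp add: K_def)
  qed
  moreover have "closed (K n)" for n
    unfolding K_def fenchel_conjugate_le_iff \<kappa>_def Ball_def
    by (intro closed_Collect_conj closed_Collect_all closed_Collect_imp closed_Collect_le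
        open_Collect_const continuous_intros)
  moreover have "bounded (K n)" for n by (auto simp: K_def bounded_iff)
  moreover have "incseq K"
    unfolding incseq_def K_def \<kappa>_def
    by (force intro: order_trans)
  moreover have "\<exists>t>0. \<exists>n. w + t *\<^sub>R v \<in> T ` K n" for v
  proof -
    obtain \<delta> where \<delta>: "\<delta> > 0" "w + \<delta> *\<^sub>R v \<in> {xs - ?Bs x | xs x. (xs, x) \<in> effective_domain ?h}
        + range (blinfun_apply (B + blinfun_adjoint B)) + barrier_cone C"
      using w unfolding core_def by force
    then obtain xs x z b where e: "w + \<delta> *\<^sub>R v = xs - ?Bs x + blinfun_apply (B + blinfun_adjoint B) z + b"
      and x: "(xs, x) \<in> effective_domain ?h" and b: "b \<in> barrier_cone C"
      by (fastforce elim!: set_plus_elim)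
    obtain a where a: "?h (xs, x) \<le> ereal a" using h_real[OF x] by blast
    obtain k where k: "\<And>c. c \<in> C \<Longrightarrow> blinfun_apply b c \<le> k" using b by (auto simp: barrier_cone_iff)
    define p where "p = blinfun_apply (B + blinfun_adjoint B) z + b"
    have p: "blinfun_apply p c - ?q c c \<le> ?q z z + k" if "c \<in> C" for c
      using square[of z c] k[OF that] by (simp add: p_def bil)
    obtain n :: nat where n: "max (norm (xs, x, p)) (max a (?q z z + k)) \<le> real n"
      using real_arch_simple by blast
    have "ereal a \<le> ereal (real n)" using n by simp
    then have "?h (xs, x) \<le> ereal (real n)" using a order_trans by blast
    moreover have "\<kappa> p (real n)" unfolding \<kappa>_def using p n by force
    ultimately have "(xs, x, p) \<in> K n" using n by (simp add: K_def)
    moreover have "w + \<delta> *\<^sub>R v = T (xs, x, p)" by (simp add: e T_def p_def)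
    ultimately show ?thesis using \<delta>(1) by blast
  qed
  ultimately obtain N \<rho> where N: "\<rho> > 0" "ball w \<rho> \<subseteq> T ` K N"
    by (rule absorbing_convex_image_contains_ball[OF T])
  \<comment> \<open>The epigraph of the value function \<open>u \<mapsto> inf {h (x*, x) + \<kappa> p - \<langle>w, x\<rangle> | x* - B* x + p = w + u}\<close>\<close>
  define P where "P = {(u, r). \<exists>xs x p a b. ?h (xs, x) \<le> ereal a \<and> \<kappa> p b
    \<and> u = T (xs, x, p) - w \<and> a + b - blinfun_apply w x \<le> r}"
  have PI: "(u, r) \<in> P" if "?h (xs, x) \<le> ereal a" "\<kappa> p b" "u = T (xs, x, p) - w"
      "a + b - blinfun_apply w x \<le> r" for u r xs x p a b
    unfolding P_def using that by blast
  have "convex P"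
  proof (rule convexI)
    fix e e' and s t :: real
    assume "e \<in> P" "e' \<in> P" and st: "0 \<le> s" "0 \<le> t" "s + t = 1"
    then obtain u r xs x p a b u' r' xs' x' p' a' b' where
      e: "e = (u, r)" "?h (xs, x) \<le> ereal a" "\<kappa> p b" "u = T (xs, x, p) - w" "a + b - blinfun_apply w x \<le> r" and
      e': "e' = (u', r')" "?h (xs', x') \<le> ereal a'" "\<kappa> p' b'" "u' = T (xs', x', p') - w" "a' + b' - blinfun_apply w x' \<le> r'"
      unfolding P_def by (elim CollectE case_prodE exE conjE) blast
    have h: "?h (s *\<^sub>R xs + t *\<^sub>R xs', s *\<^sub>R x + t *\<^sub>R x') \<le> ereal (s * a + t * a')"
      using e e' st by (intro fenchel_conjugate_convex)
    have \<kappa>: "\<kappa> (s *\<^sub>R p + t *\<^sub>R p') (s * b + t * b')"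
      unfolding \<kappa>_def
    proof
      fix c assume "c \<in> C"
      then have "s * (blinfun_apply p c - ?q c c) + t * (blinfun_apply p' c - ?q c c) \<le> s * b + t * b'"
        using e e' st by (intro add_mono mult_left_mono) (auto simp: \<kappa>_def)
      moreover have "s * ?q c c + t * ?q c c = ?q c c" using st(3) by (simp flip: distrib_right)
      ultimately show "blinfun_apply (s *\<^sub>R p + t *\<^sub>R p') c - ?q c c \<le> s * b + t * b'"
        by (simp add: blinfun.bilinear_simps right_diff_distrib)
    qed
    have "s *\<^sub>R u + t *\<^sub>R u' = s *\<^sub>R T (xs, x, p) + t *\<^sub>R T (xs', x', p') - (s + t) *\<^sub>R w"
      by (simp add: e e' algebra_simps)
    also have "\<dots> = T (s *\<^sub>R xs + t *\<^sub>R xs', s *\<^sub>R x + t *\<^sub>R x', s *\<^sub>R p + t *\<^sub>R p') - w"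
      unfolding st(3) by (simp add: T_def blinfun.bilinear_simps algebra_simps)
    finally have u: "s *\<^sub>R u + t *\<^sub>R u' = T (s *\<^sub>R xs + t *\<^sub>R xs', s *\<^sub>R x + t *\<^sub>R x', s *\<^sub>R p + t *\<^sub>R p') - w" .
    have "s * (a + b - blinfun_apply w x) + t * (a' + b' - blinfun_apply w x') \<le> s * r + t * r'"
      using e e' st by (intro add_mono mult_left_mono)
    then have "s * a + t * a' + (s * b + t * b') - blinfun_apply w (s *\<^sub>R x + t *\<^sub>R x') \<le> s * r + t * r'"
      by (simp add: blinfun.bilinear_simps algebra_simps)
    from PI[OF h \<kappa> u this] show "s *\<^sub>R e + t *\<^sub>R e' \<in> P" by (simp add: e e')
  qed
  \<comment> \<open>Both cost terms are at most \<open>N\<close>, and \<open>- w x\<close> is at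
    most \<open>norm w * N\<close>.\<close>
  moreover have "(u, 2 * real N + norm w * real N) \<in> P" if "norm u < \<rho>" for u
  proof -
    have "w + u \<in> T ` K N" using that N(2) by (auto simp: dist_norm)
    then obtain xs x p where e: "(xs, x, p) \<in> K N" "u = T (xs, x, p) - w" by (auto simp: algebra_simps)
    have "norm x \<le> norm (xs, x, p)"
      by (rule order_trans[OF norm_fst_le[of x p] norm_snd_le[of "(x, p)" xs]])
    then have "norm x \<le> real N" using e(1) by (simp add: K_def)
    then have "norm w * norm x \<le> norm w * real N" by (simp add: mult_left_mono)
    moreover have "\<bar>blinfun_apply w x\<bar> \<le> norm w * norm x" using norm_blinfun[of w x] by simp
    ultimately have r: "real N + real N - blinfun_apply w x \<le> 2 * real N + norm w * real N" by linarith
    have "?h (xs, x) \<le> ereal (real N)" "\<kappa> p (real N)" using e(1) by (simp_all add: K_def)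
    from PI[OF this e(2) r] show ?thesis .
  qed
  moreover have "0 \<le> r" if P0: "(0, r) \<in> P" for r
  proof -
    obtain xs x p a b where e: "?h (xs, x) \<le> ereal a" "\<kappa> p b" "0 = T (xs, x, p) - w"
      "a + b - blinfun_apply w x \<le> r"
      using P0 unfolding P_def by blast
    have p: "p = w - xs + ?Bs x" using e(3) by (simp add: T_def algebra_simps)
    have "x \<in> C" using dom h_dom[OF e(1)] by blast
    \<comment> \<open>Testing the supremum at \<open>c = x\<close> cancels the adjoint term against
      \<open>?q x x\<close> and leaves \<open>w x - xs x \<le> b\<close>.\<close>
    with e(2) have "blinfun_apply p x - ?q x x \<le> b" by (simp add: \<kappa>_def)
    moreover have "ereal (blinfun_apply xs x) \<le> ereal a" using h_ge e(1) order_trans by blast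
    ultimately show ?thesis using e(4) unfolding p by (simp add: bil)
  qed
  ultimately obtain g :: "'a dual dual" where g: "\<And>u r. (u, r) \<in> P \<Longrightarrow> blinfun_apply g u \<le> r"
    using convex_epigraph_affine_minorant[OF _ N(1)] by blast
  obtain y where y: "g = canonical_embedding y"
    using reflexive unfolding reflexive_space_def by (metis surjD)

  \<comment> \<open>Properties of the dual point \<open>y\<close>\<close>
  have key: "blinfun_apply (xs - ?Bs x + p - w) y \<le> a + b - blinfun_apply w x"
    if "?h (xs, x) \<le> ereal a" "\<kappa> p b" for xs x p a b
    using g[OF PI[OF that refl order_refl]] by (simp add: y canonical_embedding.rep_eq T_def)
  have "y \<in> C"
  proof (rule ccontr)
    assume "y \<notin> C"
    then obtain l :: "'a dual" and d where l: "d > 0" "\<And>c. c \<in> C \<Longrightarrow> blinfun_apply l c \<le> blinfun_apply l y - d"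
      using separate_point_closed_convex[OF C] by blast
    obtain xs x a where x: "?h (xs, x) \<le> ereal a"
    proof -
      have "w \<in> T ` K N" using N by auto
      then show ?thesis using that by (auto simp: K_def)
    qed
    \<comment> \<open>With \<open>p = t l\<close>, and \<open>?q c c \<ge> 0\<close>, the terms
      \<open>t * l y\<close> cancel in \<open>key\<close>; what remains is \<open>t * d\<close>,
      unbounded in \<open>t\<close>.\<close>
    have bound: "t * d \<le> a - blinfun_apply w x - blinfun_apply (xs - ?Bs x - w) y" if t: "t \<ge> 0" for t
    proof -
      have "\<kappa> (t *\<^sub>R l) (t * (blinfun_apply l y - d))"
        unfolding \<kappa>_def
      proof
        fix c assume "c \<in> C"
        then have "t * blinfun_apply l c \<le> t * (blinfun_apply l y - d)"
          using l(2) t by (intro mult_left_mono)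
        then show "blinfun_apply (t *\<^sub>R l) c - ?q c c \<le> t * (blinfun_apply l y - d)"
          using B[of c] by (simp add: blinfun.scaleR_left)
      qed
      from key[OF x this] show ?thesis by (simp add: bil algebra_simps)
    qed
    obtain t :: nat where "a - blinfun_apply w x - blinfun_apply (xs - ?Bs x - w) y < real t * d"
      using reals_Archimedean3[OF l(1)] by blast
    with bound[of "real t"] show False by simp
  qed
  moreover have "blinfun_apply xs y + blinfun_apply (w - blinfun_apply B y) x - a
        \<le> blinfun_apply (w - blinfun_apply B y) y" if "?h (xs, x) \<le> ereal a" for xs x a
  proof -
    \<comment> \<open>By \<open>square\<close> the choice
      \<open>p = (B + blinfun_adjoint B) y\<close> costs at most \<open>?q y y\<close>, so one of
      the two copies of \<open>?q y y\<close> on the left of \<open>key\<close> survives.\<close>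
    have "\<kappa> (blinfun_apply (B + blinfun_adjoint B) y) (?q y y)"
      unfolding \<kappa>_def using square[of y] by (simp add: bil)
    from key[OF that this] show ?thesis by (simp add: bil)
  qed
  ultimately show ?thesis by (rule that)
qed

subsection \<open>Fitzpatrick functions\<close>

text \<open>The gap into the last point ignores its second component, so \<open>ys\<close> enters
  only through the closing term at \<open>hd l\<close>.\<close>

lemma fitzpatrick_le_iff:
  assumes "n \<ge> 2"
  shows "fitzpatrick n S (y, ys) \<le> ereal c \<longleftrightarrow>
    (\<forall>l. length l = n - 1 \<and> set l \<subseteq> op_graph S \<longrightarrow>
      path_gap (l @ [(y, ys)]) + blinfun_apply ys (fst (hd l)) \<le> c)"
proof -
  define V where "V = (\<lambda>s :: nat \<Rightarrow> 'a \<times> 'a dual.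
    (\<Sum>i=1..n - 2. blinfun_apply (snd (s i)) (fst (s (i + 1)) - fst (s i)))
      + blinfun_apply (snd (s (n - 1))) (y - fst (s (n - 1))) + blinfun_apply ys (fst (s 1)))"
  have V: "V s = path_gap (map s [1..<n] @ [(y, ys)]) + blinfun_apply ys (fst (hd (map s [1..<n])))" for s
  proof -
    have ne: "map s [1..<n] \<noteq> []" "[1..<n] \<noteq> []" using assms by auto
    obtain m where n: "n = Suc (Suc m)" using assms by (metis add_2_eq_Suc le_Suc_ex)
    have "path_gap (map s [1..<n]) = (\<Sum>i=1..n - 2. blinfun_apply (snd (s i)) (fst (s (i + 1)) - fst (s i)))"
      using path_gap_upt[of 1 "Suc m" s] n by (simp add: gap_def atLeastLessThanSuc_atLeastAtMost)
    moreover have "last (map s [1..<n]) = s (n - 1)" using n by simp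
    moreover have "hd (map s [1..<n]) = s 1" using ne assms by (simp add: hd_map)
    ultimately show ?thesis using path_gap_snoc[OF ne(1), of "(y, ys)"] by (simp add: V_def gap_def)
  qed
  have "fitzpatrick n S (y, ys) \<le> ereal c \<longleftrightarrow> (\<forall>s. (\<forall>i\<in>{1..n - 1}. s i \<in> op_graph S) \<longrightarrow> V s \<le> c)"
    by (simp add: fitzpatrick_def SUP_le_iff V_def)
  also have "\<dots> \<longleftrightarrow> (\<forall>l. length l = n - 1 \<and> set l \<subseteq> op_graph S \<longrightarrow>
      path_gap (l @ [(y, ys)]) + blinfun_apply ys (fst (hd l)) \<le> c)" (is "?L \<longleftrightarrow> ?R")
  proof
    assume L: ?L
    show ?R
    proof (intro allI impI)
      fix l assume l: "length l = n - 1 \<and> set l \<subseteq> op_graph S"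
      let ?s = "\<lambda>i. l ! (i - 1)"
      have "map ?s [1..<n] = l" using l by (intro nth_equalityI) auto
      moreover have "\<forall>i\<in>{1..n - 1}. ?s i \<in> op_graph S"
        using l nth_mem[of _ l] by fastforce
      then have "V ?s \<le> c" by (rule mp[OF spec[OF L]])
      ultimately show "path_gap (l @ [(y, ys)]) + blinfun_apply ys (fst (hd l)) \<le> c"
        using V[of ?s] by simp
    qed
  next
    assume R: ?R
    show ?L
    proof (intro allI impI)
      fix s :: "nat \<Rightarrow> 'a \<times> 'a dual" assume "\<forall>i\<in>{1..n - 1}. s i \<in> op_graph S"
      then have "length (map s [1..<n]) = n - 1 \<and> set (map s [1..<n]) \<subseteq> op_graph S" by auto
      then show "V s \<le> c" unfolding V using R by blast
    qed
  qed
  finally show ?thesis .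
qed

text \<open>Each chain \<open>l\<close> gives an affine minorant of the Fitzpatrick function with
  slope \<open>(snd (last l), fst (hd l))\<close>; the conjugate at that slope is at most the
  negated constant term.\<close>

lemma fenchel_conjugate_fitzpatrick_chain:
  assumes "n \<ge> 2" "length l = n - 1" "set l \<subseteq> op_graph S"
  shows "fenchel_conjugate (fitzpatrick n S) (snd (last l), fst (hd l))
    \<le> ereal (blinfun_apply (snd (last l)) (fst (last l)) - path_gap l)"
  unfolding fenchel_conjugate_le_iff fitzpatrick_le_iff[OF assms(1)]
proof (intro allI impI)
  fix y ys c
  assume "\<forall>l. length l = n - 1 \<and> set l \<subseteq> op_graph S \<longrightarrow>
      path_gap (l @ [(y, ys)]) + blinfun_apply ys (fst (hd l)) \<le> c"
  then have "path_gap (l @ [(y, ys)]) + blinfun_apply ys (fst (hd l)) \<le> c" using assms by blast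
  moreover have "l \<noteq> []" using assms by auto
  ultimately show "blinfun_apply (snd (last l)) y + blinfun_apply ys (fst (hd l)) - c
      \<le> blinfun_apply (snd (last l)) (fst (last l)) - path_gap l"
    by (simp add: path_gap_snoc gap_def blinfun.diff_right)
qed

text \<open>Let \<open>f\<close> separate \<open>x\<close> from the closed convex hull with gap
  \<open>d\<close>. Testing the conjugate at \<open>(s, ss + t f)\<close>, with
  \<open>(s, ss)\<close> in the graph, the Fitzpatrick function grows by at most
  \<open>t (f x - d)\<close> and the pairing by \<open>t f x\<close>; so the conjugate exceeds every
  bound as \<open>t\<close> grows.\<close>

lemma effective_domain_fitzpatrick_conjugate:
  assumes "n \<ge> 2" "n_monotone n S" "op_graph S \<noteq> {}"
    and dom: "(xs, x) \<in> effective_domain (fenchel_conjugate (fitzpatrick n S))"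
  shows "x \<in> closure (convex hull (op_domain S))"
proof (rule ccontr)
  let ?C = "closure (convex hull (op_domain S))"
  assume "x \<notin> ?C"
  obtain s ss where s: "(s, ss) \<in> op_graph S" using assms(3) by auto
  have D: "y \<in> ?C" if "(y, ys) \<in> op_graph S" for y ys
    using that closure_subset hull_subset[of "op_domain S" convex] by (fastforce simp: op_graph_def op_domain_def)
  obtain f :: "'a dual" and d where f: "d > 0" "\<And>c. c \<in> ?C \<Longrightarrow> blinfun_apply f c \<le> blinfun_apply f x - d"
    using separate_point_closed_convex[of ?C x] \<open>x \<notin> ?C\<close> D[OF s]
    by (metis convex_closure convex_convex_hull closed_closure empty_iff)
  obtain a where a: "fenchel_conjugate (fitzpatrick n S) (xs, x) \<le> ereal a"
    using dom by (cases "fenchel_conjugate (fitzpatrick n S) (xs, x)") (auto simp: effective_domain_def)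
  have bound: "t * d \<le> a - (blinfun_apply xs s + blinfun_apply ss x - blinfun_apply ss s)" if t: "t \<ge> 0" for t
  proof -
    have "fitzpatrick n S (s, ss + t *\<^sub>R f) \<le> ereal (blinfun_apply ss s + t * (blinfun_apply f x - d))"
      unfolding fitzpatrick_le_iff[OF assms(1)]
    proof (intro allI impI)
      fix l assume l: "length l = n - 1 \<and> set l \<subseteq> op_graph S"
      then have ne: "l \<noteq> []" using assms(1) by auto
      \<comment> \<open>Appending \<open>(s, ss)\<close> to a chain of \<open>n - 1\<close> points
        gives a cycle of length \<open>n\<close>.\<close>
      have "path_gap ((l @ [(s, ss)]) @ [hd (l @ [(s, ss)])]) \<le> 0"
      proof -
        have "length (l @ [(s, ss)]) = n \<and> set (l @ [(s, ss)]) \<subseteq> op_graph S" using l s assms(1) by auto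
        moreover have "n \<ge> 1" using assms(1) by simp
        ultimately show ?thesis using assms(2) n_monotone_set_list_iff unfolding n_monotone_def by blast
      qed
      then have "path_gap (l @ [(s, ss)]) + (blinfun_apply ss (fst (hd l)) - blinfun_apply ss s) \<le> 0"
        using ne by (subst (asm) path_gap_snoc) (auto simp: gap_def blinfun.diff_right)
      moreover have "path_gap (l @ [(s, ss + t *\<^sub>R f)]) = path_gap (l @ [(s, ss)])"
        using ne by (simp add: path_gap_snoc gap_def)
      moreover have "t * blinfun_apply f (fst (hd l)) \<le> t * (blinfun_apply f x - d)"
        using l hd_in_set[OF ne] t by (intro mult_left_mono f(2) D[of _ "snd (hd l)"]) auto
      ultimately show "path_gap (l @ [(s, ss + t *\<^sub>R f)]) + blinfun_apply (ss + t *\<^sub>R f) (fst (hd l))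
          \<le> blinfun_apply ss s + t * (blinfun_apply f x - d)"
        by (simp add: blinfun.add_left blinfun.scaleR_left)
    qed
    with a have "blinfun_apply xs s + blinfun_apply (ss + t *\<^sub>R f) x
        - (blinfun_apply ss s + t * (blinfun_apply f x - d)) \<le> a"
      unfolding fenchel_conjugate_le_iff by blast
    then show ?thesis by (simp add: blinfun.add_left blinfun.scaleR_left right_diff_distrib)
  qed
  obtain t :: nat where "a - (blinfun_apply xs s + blinfun_apply ss x - blinfun_apply ss s) < real t * d"
    using reals_Archimedean3[OF f(1)] by blast
  with bound[of "real t"] show False by simp
qed

theorem theorem6:
  fixes S :: "'a::banach \<Rightarrow> 'a dual set"
    and B :: "'a \<Rightarrow>\<^sub>L 'a dual"
    and n :: nat
  assumes "reflexive_space TYPE('a)"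
    and "n \<ge> 2"
    and "n_monotone n S"
    and "op_graph S \<noteq> {}"
    and "\<forall>xs x. ereal (blinfun_apply xs x) \<le> fenchel_conjugate (fitzpatrick n S) (xs, x)"
    and "n_monotone 2 (\<lambda>x. {blinfun_apply B x})"
  shows "\<forall>w \<in> core
            ({xs - blinfun_apply (blinfun_adjoint B) x | xs x.
                (xs, x) \<in> effective_domain (fenchel_conjugate (fitzpatrick n S))}
             + range (blinfun_apply (B + blinfun_adjoint B))
             + barrier_cone (op_domain S)).
           \<exists>x \<in> closure (convex hull (op_domain S)).
             n_monotone_set n ({(x, w - blinfun_apply B x)} \<union> op_graph S)"
proof
  let ?C = "closure (convex hull (op_domain S))" and ?h = "fenchel_conjugate (fitzpatrick n S)"
  let ?A = "{xs - blinfun_apply (blinfun_adjoint B) x | xs x. (xs, x) \<in> effective_domain ?h}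
    + range (blinfun_apply (B + blinfun_adjoint B))"
  fix w assume "w \<in> core (?A + barrier_cone (op_domain S))"
  moreover have "core U \<subseteq> core V" if "U \<subseteq> V" for U V :: "'a dual set"
    using that unfolding core_def by blast
  \<comment> \<open>Enlarging the barrier cone keeps \<open>w\<close> in the core and provides the
    closed convex set that the duality theorem requires.\<close>
  ultimately have w: "w \<in> core (?A + barrier_cone ?C)"
    using set_plus_mono2[OF order_refl barrier_cone_closure_convex_hull] by blast
  have "op_domain S \<noteq> {}" using assms(4) by (auto simp: op_graph_def op_domain_def)
  then have C: "convex ?C" "closed ?C" "?C \<noteq> {}" by (simp_all add: convex_closure)
  obtain y where y: "y \<in> ?C" "\<And>xs x a. ?h (xs, x) \<le> ereal a \<Longrightarrow>
      blinfun_apply xs y + blinfun_apply (w - blinfun_apply B y) x - a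
        \<le> blinfun_apply (w - blinfun_apply B y) y"
    using fenchel_conjugate_duality[OF assms(1) C _ _ _ w] assms(5,6)
      effective_domain_fitzpatrick_conjugate[OF assms(2-4)] n_monotone_two_linear_iff by metis
  have "n_monotone_set n ({(y, w - blinfun_apply B y)} \<union> op_graph S)"
  proof (rule n_monotone_set_insert[OF assms(2)])
    show "n_monotone_set n (op_graph S)" using assms(3) by (simp add: n_monotone_def)
    fix l assume l: "length l = n - 1" "set l \<subseteq> op_graph S"
    then have "l \<noteq> []" using assms(2) by auto
    \<comment> \<open>At the slope of the chain \<open>l\<close>, the inequality for
      \<open>y\<close> is exactly the cycle inequality for \<open>l\<close> followed by the new
      point.\<close>
    with y(2)[OF fenchel_conjugate_fitzpatrick_chain[OF assms(2) l]]
    show "path_gap (l @ [(y, w - blinfun_apply B y)]) + gap (y, w - blinfun_apply B y) (hd l) \<le> 0"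
      by (simp add: path_gap_snoc gap_def blinfun.diff_right)
  qed
  with y(1) show "\<exists>x \<in> ?C. n_monotone_set n ({(x, w - blinfun_apply B x)} \<union> op_graph S)" by blast
qed

end
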